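(* Let $\varphi_1,\dots,\varphi_N$ be an $n$-variable DIRE family (defined in the context). Then each $\varphi_i$ is an $n$-variable algebraic function, i.e., there exists a not-identically-vanishing polynomial $F\in\mathbb C[X_1,\dots,X_{n+1}]$ such that $F(z_1,\dots,z_n,\varphi_i(z))=0$ for all $z=(z_1,\dots,z_n)$ in the domain of $\varphi_i$.
   Context: $\mathbb C[X_1,\dots,X_m]$ is the polynomial ring and $\mathbb C(X_1,\dots,X_m)$ the field of rational functions. $\Phi\in\mathbb C(X_1,\dots,X_m)$ is *defined at the origin* if $\Phi=A/B$ with $A,B\in\mathbb C[X_1,\dots,X_m]$ and $B(0)\ne0$; then $\Phi(0)=A(0)/B(0)$. Let $\varphi_1,\dots,\varphi_N$ be a finite family of holomorphic functions each defined in a connected open neighborhood of the origin in $\mathbb C^n$ (the domains need not be the same). The family is an *$n$-variable DIRE family* (defined implicitly by rational equations) if there exist $\Phi_1,\dots,\Phi_N\in\mathbb C(X_1,\dots,X_{n+N})$ such that (I) $\Phi_i$ is defined at the origin and $\Phi_i(0)=0$ for $i=1,\dots,N$; (II) $\left(\det_{i,j=1}^N\frac{\partial\Phi_i}{\partial X_{j+n}}\right)(0)\neq0$; (III) $\Phi_i(z_1,\dots,z_n,\varphi_1(z)-\varphi_1(0),\dots,\varphi_N(z)-\varphi_N(0))=0$ for $i=1,\dots,N$ and all $z=(z_1,\dots,z_n)\in\mathbb C^n$ sufficiently near the origin. *)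

theory Defs
  imports
    "HOL-Analysis.Analysis"
    "HOL-Library.Poly_Mapping"
    "HOL-Computational_Algebra.Fraction_Field"
begin

section \<open>Polynomials and rational functions in several variables\<close>

text \<open>
  The variables \<open>X\<^sub>1, \<dots>, X\<^sub>m\<close> are the elements of a finite type \<open>'v\<close> with \<open>m = CARD('v)\<close>, a
  monomial is \<open>'v \<Rightarrow>\<^sub>0 nat\<close>, and the ring structure is the convolution product of
  \<^theory>\<open>HOL-Library.Poly_Mapping\<close>. The library proves \<^class>\<open>idom\<close>, which the fraction field
  needs, only for linearly ordered variables; on \<open>'a + 'b\<close> we put the variables of \<open>'a\<close> first.
  No definition below mentions the order.
\<close>

type_synonym 'v mpoly = "('v \<Rightarrow>\<^sub>0 nat) \<Rightarrow>\<^sub>0 complex"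

type_synonym 'v ratfun = "'v mpoly fract"

instantiation sum :: (linorder, linorder) linorder
begin

definition less_eq_sum :: "'a + 'b \<Rightarrow> 'a + 'b \<Rightarrow> bool" where
  "less_eq_sum x y = (case x of
      Inl a \<Rightarrow> (case y of Inl b \<Rightarrow> a \<le> b | Inr _ \<Rightarrow> True)
    | Inr a \<Rightarrow> (case y of Inl _ \<Rightarrow> False | Inr b \<Rightarrow> a \<le> b))"

definition less_sum :: "'a + 'b \<Rightarrow> 'a + 'b \<Rightarrow> bool" where
  "less_sum x y \<longleftrightarrow> x \<le> y \<and> \<not> y \<le> x"

instance
proof
  fix x y z :: "'a + 'b"
  show "x < y \<longleftrightarrow> x \<le> y \<and> \<not> y \<le> x"
    by (rule less_sum_def)
  show "x \<le> x" "x \<le> y \<Longrightarrow> y \<le> z \<Longrightarrow> x \<le> z" "x \<le> y \<Longrightarrow> y \<le> x \<Longrightarrow> x = y" "x \<le> y \<or> y \<le> x"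
    by (cases x; cases y; cases z; auto simp: less_eq_sum_def)+
qed

end

definition mpoly_eval :: "'v mpoly \<Rightarrow> ('v \<Rightarrow> complex) \<Rightarrow> complex" where
  "mpoly_eval P x =
     (\<Sum>m\<in>Poly_Mapping.keys P.
        Poly_Mapping.lookup P m *
        (\<Prod>v\<in>Poly_Mapping.keys m. x v ^ Poly_Mapping.lookup m v))"

text \<open>If \<open>v\<close> does not occur in \<open>m\<close>, the truncated \<open>m - single v 1\<close> is harmless, since the
  coefficient is then \<open>0\<close>.\<close>

definition mpoly_deriv :: "'v \<Rightarrow> 'v mpoly \<Rightarrow> 'v mpoly" where
  "mpoly_deriv v P =
     (\<Sum>m\<in>Poly_Mapping.keys P.
        Poly_Mapping.single (m - Poly_Mapping.single v 1)
          (of_nat (Poly_Mapping.lookup m v) * Poly_Mapping.lookup P m))"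

subsection \<open>Evaluation is a ring homomorphism\<close>

lemma mpoly_induct [case_names zero single add]:
  fixes P :: "'v mpoly"
  assumes "Q 0" and "\<And>m c. Q (Poly_Mapping.single m c)"
    and "\<And>A B. Q A \<Longrightarrow> Q B \<Longrightarrow> Q (A + B)"
  shows "Q P"
proof -
  have "P = (\<Sum>m\<in>Poly_Mapping.keys P. Poly_Mapping.single m (Poly_Mapping.lookup P m))"
    by (rule poly_mapping_eqI)
      (simp add: lookup_sum lookup_single when_def in_keys_iff)
  moreover have "Q (\<Sum>m\<in>S. Poly_Mapping.single m (Poly_Mapping.lookup P m))" if "finite S" for S
    using that by (induction S) (auto intro: assms)
  ultimately show ?thesis
    by (metis finite_keys)
qed

lemma mpoly_eval_zero [simp]: "mpoly_eval 0 x = 0"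
  by (simp add: mpoly_eval_def)

lemma mpoly_eval_single:
  "mpoly_eval (Poly_Mapping.single m c) x =
     c * (\<Prod>v\<in>Poly_Mapping.keys m. x v ^ Poly_Mapping.lookup m v)"
  by (cases "c = 0") (simp_all add: mpoly_eval_def)

lemma mpoly_eval_add: "mpoly_eval (A + B) x = mpoly_eval A x + mpoly_eval B x"
  unfolding mpoly_eval_def
  by (rule setsum_keys_plus_distrib) (simp_all add: algebra_simps)

lemma monomial_eval_add:
  fixes x :: "'v \<Rightarrow> complex" and m k :: "'v \<Rightarrow>\<^sub>0 nat"
  shows "(\<Prod>v\<in>Poly_Mapping.keys (m + k). x v ^ Poly_Mapping.lookup (m + k) v) =
    (\<Prod>v\<in>Poly_Mapping.keys m. x v ^ Poly_Mapping.lookup m v) *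
    (\<Prod>v\<in>Poly_Mapping.keys k. x v ^ Poly_Mapping.lookup k v)"
proof -
  let ?K = "Poly_Mapping.keys m \<union> Poly_Mapping.keys k"
  have *: "(\<Prod>v\<in>Poly_Mapping.keys l. x v ^ Poly_Mapping.lookup l v) =
      (\<Prod>v\<in>?K. x v ^ Poly_Mapping.lookup l v)"
    if "Poly_Mapping.keys l \<subseteq> ?K" for l
    using that by (intro prod.mono_neutral_left) (auto simp: in_keys_iff)
  have "(\<Prod>v\<in>Poly_Mapping.keys (m + k). x v ^ Poly_Mapping.lookup (m + k) v) =
      (\<Prod>v\<in>?K. x v ^ Poly_Mapping.lookup m v) * (\<Prod>v\<in>?K. x v ^ Poly_Mapping.lookup k v)"
    by (subst *[OF keys_add]) (simp add: lookup_add power_add prod.distrib)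
  then show ?thesis
    using *[of m] *[of k] by simp
qed

lemma mpoly_eval_mult: "mpoly_eval (A * B) x = mpoly_eval A x * mpoly_eval B x"
proof (induction A rule: mpoly_induct)
  case (single m c)
  show ?case
  proof (induction B rule: mpoly_induct)
    case (single k d)
    then show ?case by (simp add: mult_single mpoly_eval_single monomial_eval_add)
  qed (simp_all add: distrib_left mpoly_eval_add)
qed (simp_all add: distrib_right mpoly_eval_add)

subsection \<open>Partial derivatives of rational functions\<close>

lemma mpoly_deriv_zero [simp]: "mpoly_deriv v 0 = 0"
  by (simp add: mpoly_deriv_def)

lemma mpoly_deriv_single:
  "mpoly_deriv v (Poly_Mapping.single m c) =
     Poly_Mapping.single (m - Poly_Mapping.single v 1) (of_nat (Poly_Mapping.lookup m v) * c)"
  by (cases "c = 0") (simp_all add: mpoly_deriv_def)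

lemma mpoly_deriv_add: "mpoly_deriv v (A + B) = mpoly_deriv v A + mpoly_deriv v B"
  unfolding mpoly_deriv_def
  by (rule setsum_keys_plus_distrib) (simp_all add: single_add algebra_simps)

lemma mpoly_deriv_mult:
  "mpoly_deriv v (A * B) = mpoly_deriv v A * B + A * mpoly_deriv v B"
proof (induction A rule: mpoly_induct)
  case (single m c)
  show ?case
  proof (induction B rule: mpoly_induct)
    case (single k d)
    let ?e = "Poly_Mapping.single v (1::nat)"
    have *: "a + b - ?e = (a - ?e) + b" if "Poly_Mapping.lookup a v \<noteq> 0" for a b :: "'a \<Rightarrow>\<^sub>0 nat"
      using that by (intro poly_mapping_eqI) (auto simp: lookup_add lookup_minus lookup_single when_def)
    have m: "Poly_Mapping.single (m + k - ?e) (of_nat (Poly_Mapping.lookup m v) * c * d) =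
        Poly_Mapping.single ((m - ?e) + k) (of_nat (Poly_Mapping.lookup m v) * c * d)"
      by (cases "Poly_Mapping.lookup m v = 0") (simp, simp only: * not_False_eq_True)
    have k: "Poly_Mapping.single (m + k - ?e) (of_nat (Poly_Mapping.lookup k v) * c * d) =
        Poly_Mapping.single (m + (k - ?e)) (of_nat (Poly_Mapping.lookup k v) * c * d)"
      by (cases "Poly_Mapping.lookup k v = 0") (simp, metis * add.commute)
    show ?case
      using m k
      by (simp add: mult_single mpoly_deriv_single lookup_add algebra_simps flip: single_add)
         (simp add: single_add algebra_simps)
  qed (simp_all add: distrib_left mpoly_deriv_add algebra_simps)
qed (simp_all add: distrib_right mpoly_deriv_add algebra_simps)

lift_definition ratfun_deriv :: "'v::linorder \<Rightarrow> 'v ratfun \<Rightarrow> 'v ratfun"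
  is "\<lambda>v (A, B). (mpoly_deriv v A * B - A * mpoly_deriv v B, B * B)"
proof (clarsimp)
  fix v :: 'v and A B A' B' :: "'v mpoly"
  assume eq: "A * B' = A' * B"
  then have deq: "mpoly_deriv v A * B' + A * mpoly_deriv v B' = mpoly_deriv v A' * B + A' * mpoly_deriv v B"
    by (metis mpoly_deriv_mult)
  have "b * b' * (a * b' + A * db') - A * b' * (b * db' + b' * db) = (a * b - A * db) * (b' * b')"
    for a b b' A db db' :: "'v mpoly"
    by (simp add: algebra_simps)
  from this[of B B' "mpoly_deriv v A" A "mpoly_deriv v B'" "mpoly_deriv v B"]
    this[of B' B "mpoly_deriv v A'" A' "mpoly_deriv v B" "mpoly_deriv v B'"]
  show "(mpoly_deriv v A * B - A * mpoly_deriv v B) * (B' * B') =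
      (mpoly_deriv v A' * B' - A' * mpoly_deriv v B') * (B * B)"
    by (metis eq deq add.commute mult.commute)
qed

lemma ratfun_deriv_Fract:
  "B \<noteq> 0 \<Longrightarrow> ratfun_deriv v (Fract A B) =
     Fract (mpoly_deriv v A * B - A * mpoly_deriv v B) (B * B)"
  by (simp add: Fract.abs_eq ratfun_deriv.abs_eq)

subsection \<open>Values of rational functions\<close>

text \<open>The representation \<open>A/B\<close> need not be reduced, so being defined at \<open>x\<close> means that \<^emph>\<open>some\<close>
  representation has a denominator that does not vanish at \<open>x\<close>.\<close>

definition ratfun_defined_at :: "'v::linorder ratfun \<Rightarrow> ('v \<Rightarrow> complex) \<Rightarrow> bool" where
  "ratfun_defined_at R x \<longleftrightarrow> (\<exists>A B. R = Fract A B \<and> mpoly_eval B x \<noteq> 0)"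

definition ratfun_value :: "'v::linorder ratfun \<Rightarrow> ('v \<Rightarrow> complex) \<Rightarrow> complex" where
  "ratfun_value R x =
     (THE w. \<exists>A B. R = Fract A B \<and> mpoly_eval B x \<noteq> 0 \<and> w = mpoly_eval A x / mpoly_eval B x)"

lemma ratfun_value_Fract:
  fixes A B :: "'v::linorder mpoly"
  assumes B: "mpoly_eval B x \<noteq> 0"
  shows "ratfun_value (Fract A B) x = mpoly_eval A x / mpoly_eval B x"
  unfolding ratfun_value_def
proof (rule the_equality)
  fix w
  assume "\<exists>A' B'. Fract A B = Fract A' B' \<and> mpoly_eval B' x \<noteq> 0 \<and>
    w = mpoly_eval A' x / mpoly_eval B' x"
  then obtain A' B' where eq: "Fract A B = Fract A' B'" and B': "mpoly_eval B' x \<noteq> 0"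
    and w: "w = mpoly_eval A' x / mpoly_eval B' x"
    by blast
  from B B' have "B \<noteq> 0" "B' \<noteq> 0"
    by auto
  with eq have "mpoly_eval (A * B') x = mpoly_eval (A' * B) x"
    by (simp add: eq_fract)
  then show "w = mpoly_eval A x / mpoly_eval B x"
    using B B' by (simp add: w mpoly_eval_mult frac_eq_eq)
qed (use B in blast)

section \<open>DIRE families and algebraic functions\<close>

text \<open>Holomorphy in several variables: the Frechet derivative exists and is complex linear
  (\<open>has_derivative\<close> by itself only gives a real linear map).\<close>

definition holomorphic_vec_on :: "(complex ^ 'n::finite \<Rightarrow> complex) \<Rightarrow> (complex ^ 'n) set \<Rightarrow> bool" where
  "holomorphic_vec_on f S \<longleftrightarrow>
     (\<forall>z\<in>S. \<exists>L. (f has_derivative L) (at z within S) \<and> Vector_Spaces.linear (*s) (*) L)"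

text \<open>The variables of the \<open>\<Phi> i\<close> are \<open>'n + 'N\<close>: \<open>Inl\<close> gives the \<open>n\<close> coordinates of \<open>z\<close>,
  \<open>Inr j\<close> is \<open>X\<^bsub>n+j\<^esub>\<close>. The matrix is formed in the field of rational functions, and its
  determinant is then evaluated at the origin. The definedness part of the last clause is implied
  by the first clause and continuity; it is stated because \<open>ratfun_value\<close> is only meaningful there.\<close>

definition DIRE_family ::
  "('N::{finite,linorder} \<Rightarrow> (complex ^ 'n::{finite,linorder}) set) \<Rightarrow>
   ('N \<Rightarrow> complex ^ 'n::{finite,linorder} \<Rightarrow> complex) \<Rightarrow> bool" where
  "DIRE_family D \<phi> \<longleftrightarrow>
     (\<forall>i. open (D i) \<and> connected (D i) \<and> 0 \<in> D i \<and> holomorphic_vec_on (\<phi> i) (D i)) \<and>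
     (\<exists>\<Phi> :: 'N \<Rightarrow> ('n + 'N) ratfun.
        (\<forall>i. ratfun_defined_at (\<Phi> i) (\<lambda>_. 0) \<and> ratfun_value (\<Phi> i) (\<lambda>_. 0) = 0) \<and>
        ratfun_value (det (\<chi> i j. ratfun_deriv (Inr j) (\<Phi> i))) (\<lambda>_. 0) \<noteq> 0 \<and>
        (\<forall>i. \<forall>\<^sub>F z in nhds 0.
           let x = case_sum (\<lambda>k. z $ k) (\<lambda>j. \<phi> j z - \<phi> j 0)
           in ratfun_defined_at (\<Phi> i) x \<and> ratfun_value (\<Phi> i) x = 0))"

text \<open>The variables of \<open>F\<close> are \<open>'n + unit\<close>; \<open>Inr ()\<close> is \<open>X\<^bsub>n+1\<^esub>\<close>.\<close>

definition algebraic_function_on ::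
  "(complex ^ 'n::finite) set \<Rightarrow> (complex ^ 'n \<Rightarrow> complex) \<Rightarrow> bool" where
  "algebraic_function_on S f \<longleftrightarrow>
     (\<exists>F :: ('n + unit) mpoly. F \<noteq> 0 \<and>
        (\<forall>z\<in>S. mpoly_eval F (case_sum (\<lambda>k. z $ k) (\<lambda>_. f z)) = 0))"

end

theory Submission
  imports Defs "HOL-Complex_Analysis.Complex_Analysis"
    "HOL-Computational_Algebra.Polynomial_Factorial"
begin

text \<open>
  Clearing denominators, the functions \<open>w\<^sub>j = \<phi>\<^sub>j - \<phi>\<^sub>j(0)\<close> satisfy \<open>N\<close> polynomial equations
  \<open>A\<^sub>i(z, w) = 0\<close> with nonvanishing Jacobian in \<open>w\<close>. In the quotient field \<open>L\<close> of the ring of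
  holomorphic germs at the origin, this forces each \<open>w\<^sub>j\<close> to be algebraic over \<open>k = \<complex>(z)\<close>:
  write \<open>A\<^sub>i(X) - A\<^sub>i(Y) = \<Sum>\<^sub>j M\<^sub>i\<^sub>j(X, Y) (X\<^sub>j - Y\<^sub>j)\<close>, where \<open>M\<close> restricts to the Jacobian on the
  diagonal, and let \<open>g = det M\<close>. By Cramer's rule \<open>g (X\<^sub>j - Y\<^sub>j)\<close> lies in the ideal generated by
  the \<open>A\<^sub>i(X)\<close> and \<open>A\<^sub>i(Y)\<close>. A \<open>k\<close>-linear functional \<open>\<theta>\<close> on \<open>L\<close> may be multiplied by \<open>w\<close> on the left
  (for \<open>X\<close>) and on the right (for \<open>Y\<close>); hence \<open>g(X, Y) \<cdot> \<theta>\<close> is an operator of finite rank on \<open>L\<close> that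
  commutes with multiplication by every \<open>w\<^sub>j\<close>. Since \<open>g(w, w) \<noteq> 0\<close>, it is nonzero for some \<open>\<theta>\<close>,
  and then its image is a nonzero finite-dimensional space stable under \<open>w\<^sub>j\<close>. The resulting
  algebraic relation between germs extends to the whole domain by the identity theorem.
\<close>

section \<open>Polynomials\<close>

definition mpoly_const :: "complex \<Rightarrow> 'v mpoly" where
  "mpoly_const c = Poly_Mapping.single 0 c"

definition mpoly_var :: "'v \<Rightarrow> 'v mpoly" where
  "mpoly_var v = Poly_Mapping.single (Poly_Mapping.single v 1) 1"

text \<open>Any monomial other than 1 splits off a variable, so a single term is handled by
  induction on its total degree. The rule suits properties that respect the ring operations.\<close>

lemma mpoly_ring_induct [case_names const var add mult]:
  fixes P :: "'v::finite mpoly"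
  assumes const: "\<And>c. Q (mpoly_const c)" and var: "\<And>v. Q (mpoly_var v)"
    and add: "\<And>A B. Q A \<Longrightarrow> Q B \<Longrightarrow> Q (A + B)"
    and mult: "\<And>A B. Q A \<Longrightarrow> Q B \<Longrightarrow> Q (A * B)"
  shows "Q P"
proof (induction P rule: mpoly_induct)
  case zero
  show ?case using const[of 0] by (simp add: mpoly_const_def)
next
  case (single m c)
  show ?case
  proof (induction "\<Sum>v\<in>UNIV. Poly_Mapping.lookup m v" arbitrary: m rule: less_induct)
    case less
    show ?case
    proof (cases "m = 0")
      case True
      then show ?thesis using const[of c] by (simp add: mpoly_const_def)
    next
      case False
      then obtain v where v: "Poly_Mapping.lookup m v \<noteq> 0"
        by (metis poly_mapping_eqI lookup_zero)
      define k where "k = m - Poly_Mapping.single v 1"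
      have m: "m = k + Poly_Mapping.single v 1"
        using v by (intro poly_mapping_eqI)
          (auto simp: k_def lookup_add lookup_minus lookup_single when_def)
      have "(\<Sum>w\<in>UNIV. Poly_Mapping.lookup k w) < (\<Sum>w\<in>UNIV. Poly_Mapping.lookup m w)"
        by (rule sum_strict_mono_ex1) (auto simp: m lookup_add intro!: exI[of _ v])
      then have "Q (Poly_Mapping.single k c * mpoly_var v)"
        by (intro mult var less)
      then show ?thesis by (simp only: mpoly_var_def mult_single mult_1_right m[symmetric])
    qed
  qed
qed (rule add)

lemma mpoly_eval_const [simp]: "mpoly_eval (mpoly_const c) x = c"
  by (simp add: mpoly_const_def mpoly_eval_single)

lemma mpoly_eval_var [simp]: "mpoly_eval (mpoly_var v) x = x v"
  by (simp add: mpoly_var_def mpoly_eval_single)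

lemma mpoly_eval_1 [simp]: "mpoly_eval 1 x = 1"
  using mpoly_eval_const[of 1 x] by (simp add: mpoly_const_def)

lemma mpoly_eval_uminus: "mpoly_eval (- A) x = - mpoly_eval A x"
  using mpoly_eval_add[of A "- A" x] by (simp add: minus_unique)

lemma mpoly_eval_diff: "mpoly_eval (A - B) x = mpoly_eval A x - mpoly_eval B x"
  using mpoly_eval_add[of A "- B" x] by (simp add: mpoly_eval_uminus)

lemma mpoly_deriv_const [simp]: "mpoly_deriv v (mpoly_const c) = 0"
  by (simp add: mpoly_const_def mpoly_deriv_single)

lemma mpoly_deriv_var: "mpoly_deriv v (mpoly_var w) = (if v = w then 1 else 0)"
  by (simp add: mpoly_var_def mpoly_deriv_single lookup_single when_def)

lemma sum_UNIV_sum_type: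
  fixes f :: "'a::finite + 'b::finite \<Rightarrow> 'c::comm_monoid_add"
  shows "sum f UNIV = (\<Sum>a\<in>UNIV. f (Inl a)) + (\<Sum>b\<in>UNIV. f (Inr b))"
  by (subst UNIV_Plus_UNIV[symmetric], subst sum.Plus) simp_all

lemma prod_UNIV_sum_type:
  fixes f :: "'a::finite + 'b::finite \<Rightarrow> 'c::comm_monoid_mult"
  shows "prod f UNIV = (\<Prod>a\<in>UNIV. f (Inl a)) * (\<Prod>b\<in>UNIV. f (Inr b))"
  by (subst UNIV_Plus_UNIV[symmetric], subst prod.Plus) simp_all

section \<open>Evaluation of complex polynomials in commutative rings\<close>

definition monom_at :: "('v::finite \<Rightarrow> 'l::comm_ring_1) \<Rightarrow> ('v \<Rightarrow>\<^sub>0 nat) \<Rightarrow> 'l" where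
  "monom_at u m = (\<Prod>v\<in>UNIV. u v ^ Poly_Mapping.lookup m v)"

lemma monom_at_0 [simp]: "monom_at u 0 = 1"
  by (simp add: monom_at_def)

lemma monom_at_add: "monom_at u (m + k) = monom_at u m * monom_at u k"
  by (simp add: monom_at_def lookup_add power_add prod.distrib)

lemma monom_at_single [simp]: "monom_at u (Poly_Mapping.single v 1) = u v"
proof -
  have "monom_at u (Poly_Mapping.single v 1) = (\<Prod>w\<in>UNIV. if w = v then u v else 1)"
    unfolding monom_at_def by (rule prod.cong) (auto simp: lookup_single when_def)
  then show ?thesis by simp
qed

text \<open>One evaluation map \<open>ev\<close> serves three targets: polynomial rings, the complex
  numbers, and the fraction field of germs.\<close>

locale complex_hom =
  fixes \<kappa> :: "complex \<Rightarrow> 'l::comm_ring_1"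
  assumes hom_add: "\<kappa> (a + b) = \<kappa> a + \<kappa> b"
    and hom_mult: "\<kappa> (a * b) = \<kappa> a * \<kappa> b"
    and hom_one: "\<kappa> 1 = 1"
begin

lemma hom_zero: "\<kappa> 0 = 0"
  using hom_add[of 0 0] by simp

definition ev :: "'v::finite mpoly \<Rightarrow> ('v \<Rightarrow> 'l) \<Rightarrow> 'l" where
  "ev P u = (\<Sum>m\<in>Poly_Mapping.keys P. \<kappa> (Poly_Mapping.lookup P m) * monom_at u m)"

lemma ev_zero [simp]: "ev 0 u = 0"
  by (simp add: ev_def)

lemma ev_single: "ev (Poly_Mapping.single m c) u = \<kappa> c * monom_at u m"
  by (cases "c = 0") (simp_all add: ev_def hom_zero)

lemma ev_add: "ev (A + B) u = ev A u + ev B u"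
  unfolding ev_def by (rule setsum_keys_plus_distrib) (simp_all add: hom_zero hom_add algebra_simps)

lemma ev_mult: "ev (A * B) u = ev A u * ev B u"
proof (induction A rule: mpoly_induct)
  case (single m c)
  show ?case
  proof (induction B rule: mpoly_induct)
    case (single k d)
    then show ?case by (simp add: mult_single ev_single monom_at_add hom_mult)
  qed (simp_all add: distrib_left ev_add)
qed (simp_all add: distrib_right ev_add)

lemma ev_const [simp]: "ev (mpoly_const c) u = \<kappa> c"
  by (simp add: mpoly_const_def ev_single)

lemma ev_var [simp]: "ev (mpoly_var v) u = u v"
  by (simp add: mpoly_var_def ev_single hom_one flip: One_nat_def)

lemma ev_one [simp]: "ev 1 u = 1"
  using ev_const[of 1 u] by (simp add: mpoly_const_def hom_one)

lemma ev_uminus: "ev (- A) u = - ev A u"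
  using ev_add[of A "- A" u] by (simp add: minus_unique)

lemma ev_of_int: "ev (of_int k) u = of_int k"
proof -
  have "ev (of_nat n) u = of_nat n" for n
    by (induction n) (simp_all add: ev_add)
  then show ?thesis
    by (cases k rule: int_cases2) (simp_all add: ev_uminus)
qed

lemma ev_sum: "ev (\<Sum>i\<in>S. f i) u = (\<Sum>i\<in>S. ev (f i) u)"
  by (induction S rule: infinite_finite_induct) (simp_all add: ev_add)

lemma ev_prod: "ev (\<Prod>i\<in>S. f i) u = (\<Prod>i\<in>S. ev (f i) u)"
  by (induction S rule: infinite_finite_induct) (simp_all add: ev_mult)

lemma ev_det: "ev (det M) u = det (\<chi> i j. ev (M $ i $ j) u)"
  by (simp add: det_def ev_sum ev_mult ev_prod ev_of_int)

end

text \<open>With polynomials as target, \<open>const.ev P f\<close> is the substitution of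
  \<open>f v\<close> for each variable \<open>v\<close>.\<close>

interpretation const: complex_hom "mpoly_const :: complex \<Rightarrow> 'v mpoly"
  by unfold_locales (simp_all add: mpoly_const_def single_add mult_single)

interpretation id: complex_hom "\<lambda>c :: complex. c"
  by unfold_locales simp_all

lemma mpoly_eval_eq_ev: "mpoly_eval P x = id.ev P x"
  by (induction P rule: mpoly_ring_induct) (simp_all add: mpoly_eval_add mpoly_eval_mult id.ev_add id.ev_mult)

lemma (in complex_hom) ev_compose:
  "ev (const.ev P f) u = ev P (\<lambda>v. ev (f v) u)"
  by (induction P rule: mpoly_ring_induct) (simp_all add: ev_add ev_mult const.ev_add const.ev_mult)

lemma (in complex_hom) ev_power: "ev (P ^ d) u = ev P u ^ d"
  by (induction d) (simp_all add: ev_mult)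

section \<open>Doubled variables (\<open>Inl\<close> for X, \<open>Inr\<close> for Y) and
  first-order Taylor expansion\<close>

definition lcopy :: "'v::finite mpoly \<Rightarrow> ('v + 'v) mpoly" where
  "lcopy P = const.ev P (\<lambda>v. mpoly_var (Inl v))"

definition rcopy :: "'v::finite mpoly \<Rightarrow> ('v + 'v) mpoly" where
  "rcopy P = const.ev P (\<lambda>v. mpoly_var (Inr v))"

lemma lcopy_simps [simp]:
  "lcopy (mpoly_const c) = mpoly_const c" "lcopy (mpoly_var v) = mpoly_var (Inl v)"
  "lcopy (A + B) = lcopy A + lcopy B" "lcopy (A * B) = lcopy A * lcopy B"
  by (simp_all add: lcopy_def const.ev_add const.ev_mult)

lemma rcopy_simps [simp]:
  "rcopy (mpoly_const c) = mpoly_const c" "rcopy (mpoly_var v) = mpoly_var (Inr v)"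
  "rcopy (A + B) = rcopy A + rcopy B" "rcopy (A * B) = rcopy A * rcopy B"
  by (simp_all add: rcopy_def const.ev_add const.ev_mult)

context complex_hom
begin

lemma ev_lcopy: "ev (lcopy A) u = ev A (\<lambda>v. u (Inl v))"
  by (induction A rule: mpoly_ring_induct) (simp_all add: ev_add ev_mult)

lemma ev_rcopy: "ev (rcopy A) u = ev A (\<lambda>v. u (Inr v))"
  by (induction A rule: mpoly_ring_induct) (simp_all add: ev_add ev_mult)

text \<open>The coefficients \<open>M v\<close> are built along the ring structure of
  \<open>A\<close>; on the diagonal they obey the rules of differentiation.\<close>

lemma taylor_first_order:
  fixes A :: "'v::finite mpoly"
  obtains M where
    "lcopy A - rcopy A = (\<Sum>v\<in>UNIV. M v * (mpoly_var (Inl v) - mpoly_var (Inr v)))"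
    "\<And>v. ev (M v) (case_sum u u) = ev (mpoly_deriv v A) u"
proof -
  have "\<exists>M. lcopy A - rcopy A = (\<Sum>v\<in>UNIV. M v * (mpoly_var (Inl v) - mpoly_var (Inr v))) \<and>
    (\<forall>v. ev (M v) (case_sum u u) = ev (mpoly_deriv v A) u)"
  proof (induction A rule: mpoly_ring_induct)
    case (const c)
    show ?case by (rule exI[of _ "\<lambda>_. 0"]) simp
  next
    case (var w)
    show ?case
      by (rule exI[of _ "\<lambda>v. if v = w then 1 else 0"])
        (auto simp: mpoly_deriv_var if_distrib[of "\<lambda>x. x * _"] cong: if_cong)
  next
    case (add A B)
    then obtain M N where
      "lcopy A - rcopy A = (\<Sum>v\<in>UNIV. M v * (mpoly_var (Inl v) - mpoly_var (Inr v)))"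
      "\<And>v. ev (M v) (case_sum u u) = ev (mpoly_deriv v A) u"
      "lcopy B - rcopy B = (\<Sum>v\<in>UNIV. N v * (mpoly_var (Inl v) - mpoly_var (Inr v)))"
      "\<And>v. ev (N v) (case_sum u u) = ev (mpoly_deriv v B) u"
      by blast
    moreover have "lcopy (A + B) - rcopy (A + B) = (lcopy A - rcopy A) + (lcopy B - rcopy B)"
      by simp
    ultimately show ?case
      by (intro exI[of _ "\<lambda>v. M v + N v"])
        (simp add: ev_add mpoly_deriv_add distrib_right sum.distrib)
  next
    case (mult A B)
    then obtain M N where
      MN: "lcopy A - rcopy A = (\<Sum>v\<in>UNIV. M v * (mpoly_var (Inl v) - mpoly_var (Inr v)))"
      "\<And>v. ev (M v) (case_sum u u) = ev (mpoly_deriv v A) u"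
      "lcopy B - rcopy B = (\<Sum>v\<in>UNIV. N v * (mpoly_var (Inl v) - mpoly_var (Inr v)))"
      "\<And>v. ev (N v) (case_sum u u) = ev (mpoly_deriv v B) u"
      by blast
    \<comment> \<open>This telescoping becomes the Leibniz rule once both copies are
      identified.\<close>
    have "lcopy (A * B) - rcopy (A * B) =
        (lcopy A - rcopy A) * rcopy B + lcopy A * (lcopy B - rcopy B)"
      by (simp add: algebra_simps)
    also have "\<dots> = (\<Sum>v\<in>UNIV. (M v * rcopy B + lcopy A * N v) *
        (mpoly_var (Inl v) - mpoly_var (Inr v)))"
      unfolding MN sum_distrib_left sum_distrib_right sum.distrib[symmetric]
      by (rule sum.cong) (simp_all add: algebra_simps)
    finally show ?case
      using MN(2,4)
      by (intro exI[of _ "\<lambda>v. M v * rcopy B + lcopy A * N v"])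
        (simp add: ev_add ev_mult mpoly_deriv_mult ev_lcopy ev_rcopy)
  qed
  then show ?thesis using that by blast
qed

end

text \<open>Cramer's rule without division. The \<open>c i\<close> are cofactors of
  \<open>M\<close>, independent of \<open>x\<close>.\<close>

lemma det_times_coord:
  fixes M :: "'a::comm_ring_1 ^ 'n ^ 'n"
  obtains c where "\<And>x. det M * x $ k = (\<Sum>i\<in>UNIV. c i * (M *v x) $ i)"
proof -
  define N where "N = transpose M"
  \<comment> \<open>\<open>D r\<close> is the determinant of \<open>M\<close> with column
    \<open>k\<close> replaced by \<open>r\<close>. The transpose makes this a row, in which
    \<open>det\<close> is linear.\<close>
  define D where "D r = det (\<chi> i. if i = k then r else N $ i)" for r :: "'a ^ 'n"
  have D_scale: "D (a *s r) = a * D r" for a r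
    unfolding D_def by (rule det_row_mul[of k a "\<lambda>_. r" "\<lambda>i. N $ i"])
  have D_sum: "D (sum f UNIV) = (\<Sum>i\<in>UNIV. D (f i))" for f :: "'n \<Rightarrow> 'a ^ 'n"
    unfolding D_def by (rule det_linear_row_sum[of UNIV k "\<lambda>_. f" "\<lambda>i. N $ i"]) simp
  have D_row: "D (N $ j) = (if j = k then det M else 0)" for j
  proof (cases "j = k")
    case True
    then have "(\<chi> i. if i = k then N $ j else N $ i) = N" by (simp add: vec_eq_iff)
    then have "D (N $ j) = det N" by (simp only: D_def)
    with True show ?thesis by (simp add: N_def)
  next
    case False
    then show ?thesis
      unfolding D_def by (subst det_identical_rows[of j k]) (auto simp: row_def)
  qed
  have "det M * x $ k = (\<Sum>i\<in>UNIV. D (axis i 1) * (M *v x) $ i)" for x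
  proof -
    \<comment> \<open>\<open>D\<close> is applied to two expansions of \<open>M *v x\<close>: in the
      columns of \<open>M\<close>, where only column \<open>k\<close> contributes, and in the
      standard basis.\<close>
    have "M *v x = (\<Sum>j\<in>UNIV. x $ j *s N $ j)"
      by (simp add: vec_eq_iff matrix_vector_mult_def N_def transpose_def mult.commute)
    moreover have "M *v x = (\<Sum>i\<in>UNIV. (M *v x) $ i *s axis i 1)"
      by (simp add: basis_expansion)
    ultimately have "(\<Sum>j\<in>UNIV. x $ j *s N $ j) = (\<Sum>i\<in>UNIV. (M *v x) $ i *s axis i 1)"
      by (rule trans[OF sym])
    from arg_cong[OF this, of D]
    show ?thesis
      by (simp add: D_sum D_scale D_row if_distrib mult.commute cong: if_cong)
  qed
  then show ?thesis by (rule that)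
qed

section \<open>A Jacobian criterion for algebraicity\<close>

locale field_hom =
  fixes \<iota> :: "'k::field \<Rightarrow> 'l::field"
  assumes \<iota>_add: "\<iota> (a + b) = \<iota> a + \<iota> b"
    and \<iota>_mult: "\<iota> (a * b) = \<iota> a * \<iota> b"
    and \<iota>_one: "\<iota> 1 = 1"
begin

lemma \<iota>_zero [simp]: "\<iota> 0 = 0"
  by (metis \<iota>_add add_cancel_right_left add_0)

lemma \<iota>_eq_0_iff [simp]: "\<iota> a = 0 \<longleftrightarrow> a = 0"
  by (metis \<iota>_mult \<iota>_one \<iota>_zero mult_zero_left right_inverse zero_neq_one)

definition scale :: "'k \<Rightarrow> 'l \<Rightarrow> 'l" where
  "scale a x = \<iota> a * x"

sublocale vs: vector_space scale
  by unfold_locales (simp_all add: scale_def \<iota>_add \<iota>_mult \<iota>_one algebra_simps)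

definition algebraic_elem :: "'l \<Rightarrow> bool" where
  "algebraic_elem t \<longleftrightarrow> (\<exists>p. p \<noteq> 0 \<and> poly (map_poly \<iota> p) t = 0)"

lemma poly_map_poly_eq_sum: "poly (map_poly \<iota> p) t = (\<Sum>d\<le>degree p. \<iota> (coeff p d) * t ^ d)"
  by (simp add: poly_altdef degree_map_poly coeff_map_poly)

lemma algebraic_elemI:
  fixes c :: "nat \<Rightarrow> 'k"
  assumes fin: "finite D" and sum: "(\<Sum>d\<in>D. \<iota> (c d) * t ^ d) = 0" and nz: "d \<in> D" "c d \<noteq> 0"
  shows "algebraic_elem t"
proof -
  define p where "p = (\<Sum>d\<in>D. monom (c d) d)"
  have coeff: "coeff p e = (if e \<in> D then c e else 0)" for e
    using fin by (simp add: p_def coeff_sum if_distrib cong: if_cong)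
  have "(\<Sum>d\<le>degree p. \<iota> (coeff p d) * t ^ d) = (\<Sum>d\<in>D. \<iota> (c d) * t ^ d)"
  proof (rule sum.mono_neutral_cong)
    fix e assume "e \<in> D - {..degree p}"
    then have "coeff p e = 0" by (intro coeff_eq_0) simp
    with \<open>e \<in> D - {..degree p}\<close> show "\<iota> (c e) * t ^ e = 0" by (simp add: coeff)
  qed (use fin in \<open>auto simp: coeff\<close>)
  moreover have "p \<noteq> 0" using nz coeff[of d] by auto
  ultimately show ?thesis
    unfolding algebraic_elem_def poly_map_poly_eq_sum using sum by auto
qed

text \<open>A nonzero finite-dimensional subspace stable under multiplication by \<open>t\<close> makes \<open>t\<close>
  algebraic.\<close>

lemma algebraic_elem_if_powers_in_span:
  assumes fin: "finite W" and u: "u \<noteq> 0" and span: "\<And>d. t ^ d * u \<in> vs.span W"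
  shows "algebraic_elem t"
proof (cases "inj_on (\<lambda>d. t ^ d * u) {..card W}")
  \<comment> \<open>Two equal powers of \<open>t\<close> already give the relation
    \<open>t ^ d - t ^ e = 0\<close>.\<close>
  case False
  then obtain d e where de: "d \<noteq> e" "t ^ d = t ^ e"
    using u by (auto simp: inj_on_def)
  show ?thesis
  proof (rule algebraic_elemI)
    have "\<iota> (- 1) = - 1" using minus_unique[of "\<iota> 1" "\<iota> (- 1)"] \<iota>_add[of 1 "- 1"] by (simp add: \<iota>_one)
    with de show "(\<Sum>x\<in>{d, e}. \<iota> (if x = d then 1 else - 1) * t ^ x) = 0"
      by (simp add: \<iota>_one)
  qed auto
next
  case True
  let ?S = "(\<lambda>d. t ^ d * u) ` {..card W}"
  have "card ?S = Suc (card W)" using True by (simp add: card_image)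
  moreover have "?S \<subseteq> vs.span W" using span by auto
  \<comment> \<open>The exponents run from 0 to \<open>card W\<close>, one vector more than the
    spanning set has.\<close>
  ultimately have "vs.dependent ?S"
    using vs.independent_span_bound[OF fin, of ?S] by force
  then obtain S f v where S: "finite S" "S \<subseteq> ?S" "(\<Sum>v\<in>S. scale (f v) v) = 0" "v \<in> S" "f v \<noteq> 0"
    unfolding vs.dependent_explicit by blast
  \<comment> \<open>Injectivity turns the relation between vectors back into one indexed by
    exponents.\<close>
  define D where "D = {d \<in> {..card W}. t ^ d * u \<in> S}"
  have "bij_betw (\<lambda>d. t ^ d * u) D S"
    using S(2) inj_on_subset[OF True, of D] by (auto simp: bij_betw_def D_def)
  then have "(\<Sum>d\<in>D. \<iota> (f (t ^ d * u)) * (t ^ d * u)) = 0"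
    using S(3) sum.reindex_bij_betw[of "\<lambda>d. t ^ d * u" D S "\<lambda>v. scale (f v) v"]
    by (simp add: scale_def)
  then have "(\<Sum>d\<in>D. \<iota> (f (t ^ d * u)) * t ^ d) * u = 0"
    by (simp add: sum_distrib_right mult.assoc)
  then have "(\<Sum>d\<in>D. \<iota> (f (t ^ d * u)) * t ^ d) = 0" using u by simp
  moreover obtain d where "d \<in> D" "f (t ^ d * u) \<noteq> 0" using S by (auto simp: D_def)
  ultimately show ?thesis
    by (intro algebraic_elemI[of D "\<lambda>d. f (t ^ d * u)"]) (auto simp: D_def)
qed

definition functional :: "('l \<Rightarrow> 'k) \<Rightarrow> bool" where
  "functional \<theta> \<longleftrightarrow> (\<forall>x y. \<theta> (x + y) = \<theta> x + \<theta> y) \<and> (\<forall>c x. \<theta> (\<iota> c * x) = c * \<theta> x)"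

text \<open>The tensor \<open>\<Sum> a\<^sub>i \<otimes> b\<^sub>i\<close> over \<open>k\<close> is nonzero because its image \<open>\<Sum> a\<^sub>i b\<^sub>i\<close> under
  multiplication is.\<close>

lemma functional_detects_tensor:
  assumes fin: "finite I" and nz: "(\<Sum>i\<in>I. a i * b i) \<noteq> 0"
  obtains \<theta> where "functional \<theta>"
    "(\<Sum>i\<in>I. a i * \<iota> (\<theta> (b i))) \<noteq> 0"
proof -
  \<comment> \<open>Expanding the \<open>b i\<close> in a basis of the extension, some basis vector
    \<open>e\<close> has a nonzero total coefficient; \<theta> is the coordinate form of that
    \<open>e\<close>.\<close>
  define B where "B = vs.extend_basis {}"
  have B: "vs.independent B" "vs.span B = UNIV"
    using vs.independent_extend_basis[OF vs.independent_empty] vs.span_extend_basis[OF vs.independent_empty]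
    by (simp_all add: B_def)
  let ?R = "vs.representation B"
  define S where "S = (\<Union>i\<in>I. {e. ?R (b i) e \<noteq> 0})"
  have finS: "finite S" using fin by (simp add: S_def vs.finite_representation)
  have b: "b i = (\<Sum>e\<in>S. \<iota> (?R (b i) e) * e)" if "i \<in> I" for i
  proof -
    have "b i = (\<Sum>e | ?R (b i) e \<noteq> 0. scale (?R (b i) e) e)"
      using B by (simp add: vs.sum_nonzero_representation_eq)
    also have "\<dots> = (\<Sum>e\<in>S. \<iota> (?R (b i) e) * e)"
      using that finS by (intro sum.mono_neutral_cong_left) (auto simp: S_def scale_def)
    finally show ?thesis .
  qed
  have "(\<Sum>i\<in>I. a i * b i) = (\<Sum>i\<in>I. \<Sum>e\<in>S. a i * \<iota> (?R (b i) e) * e)"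
  proof (rule sum.cong)
    fix i assume "i \<in> I"
    then have "a i * b i = a i * (\<Sum>e\<in>S. \<iota> (?R (b i) e) * e)" by (simp only: b[symmetric])
    then show "a i * b i = (\<Sum>e\<in>S. a i * \<iota> (?R (b i) e) * e)"
      by (simp only: sum_distrib_left mult.assoc)
  qed simp
  also have "\<dots> = (\<Sum>e\<in>S. (\<Sum>i\<in>I. a i * \<iota> (?R (b i) e)) * e)"
    by (subst sum.swap) (simp add: sum_distrib_right)
  finally obtain e where "(\<Sum>i\<in>I. a i * \<iota> (?R (b i) e)) \<noteq> 0"
    using nz by (metis (no_types, lifting) mult_zero_left sum.neutral)
  moreover have "?R (x + y) e = ?R x e + ?R y e" for x y
    using B by (simp add: vs.representation_add)
  moreover have "?R (\<iota> c * x) e = c * ?R x e" for c x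
    using B vs.representation_scale[of B x c] by (simp add: scale_def)
  ultimately show thesis by (intro that[of "\<lambda>x. ?R x e"]) (simp_all add: functional_def)
qed

end

text \<open>In the application \<open>'k\<close> is the field of rational functions in z and
  \<open>'l\<close> the fraction field of germs; \<open>u (Inl k)\<close> is the coordinate function
  \<open>z $ k\<close> and \<open>u (Inr j)\<close> is the unknown function
  \<open>\<phi> j - \<phi> j 0\<close>.\<close>

locale jacobian_criterion = complex_hom \<kappa> + field_hom \<iota>
  for \<kappa> :: "complex \<Rightarrow> 'l::field" and \<iota> :: "'k::field \<Rightarrow> 'l" +
  fixes A :: "'N::finite \<Rightarrow> ('n::finite + 'N) mpoly" and u :: "'n + 'N \<Rightarrow> 'l"
  assumes \<kappa>_in: "\<kappa> c \<in> range \<iota>" and u_in: "u (Inl k) \<in> range \<iota>"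
    and ev_A: "ev (A i) u = 0"
    and jacobian: "ev (det (\<chi> i j. mpoly_deriv (Inr j) (A i))) u \<noteq> 0"
begin

text \<open>A polynomial \<open>q\<close> in the doubled variables acts on linear functionals \<open>\<theta>\<close>: the first copy
  acts by multiplication after \<open>\<theta>\<close>, the second copy by multiplication before \<open>\<theta>\<close>.\<close>

definition twist :: "('l \<Rightarrow> 'k) \<Rightarrow> (('n + 'N) + ('n + 'N)) mpoly \<Rightarrow> 'l \<Rightarrow> 'l" where
  "twist \<theta> q x = (\<Sum>m\<in>Poly_Mapping.keys q. \<kappa> (Poly_Mapping.lookup q m) *
     monom_at (case_sum u (\<lambda>_. 1)) m * \<iota> (\<theta> (monom_at (case_sum (\<lambda>_. 1) u) m * x)))"

lemma twist_zero [simp]: "twist \<theta> 0 x = 0"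
  by (simp add: twist_def)

lemma twist_add: "twist \<theta> (p + q) x = twist \<theta> p x + twist \<theta> q x"
  unfolding twist_def by (rule setsum_keys_plus_distrib) (simp_all add: hom_zero hom_add algebra_simps)

lemma twist_uminus: "twist \<theta> (- p) x = - twist \<theta> p x"
  using twist_add[of \<theta> p "- p" x] by (simp add: minus_unique)

lemma twist_diff: "twist \<theta> (p - q) x = twist \<theta> p x - twist \<theta> q x"
  using twist_add[of \<theta> p "- q" x] by (simp add: twist_uminus)

lemma twist_sum: "twist \<theta> (\<Sum>i\<in>S. f i) x = (\<Sum>i\<in>S. twist \<theta> (f i) x)"
  by (induction S rule: infinite_finite_induct) (simp_all add: twist_add)

lemma twist_single: "twist \<theta> (Poly_Mapping.single m c) x = \<kappa> c *
     monom_at (case_sum u (\<lambda>_. 1)) m * \<iota> (\<theta> (monom_at (case_sum (\<lambda>_. 1) u) m * x))"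
  by (cases "c = 0") (simp_all add: twist_def hom_zero)

lemma twist_single_mult: "twist \<theta> (Poly_Mapping.single m c * q) x = \<kappa> c *
     monom_at (case_sum u (\<lambda>_. 1)) m * twist \<theta> q (monom_at (case_sum (\<lambda>_. 1) u) m * x)"
proof (induction q rule: mpoly_induct)
  case (single k d)
  then show ?case
    by (simp add: mult_single twist_single monom_at_add hom_mult mult_ac)
qed (simp_all add: twist_add distrib_left)

lemma twist_const: "twist \<theta> (mpoly_const c * q) x = \<kappa> c * twist \<theta> q x"
  by (simp add: mpoly_const_def twist_single_mult)

lemma twist_Inl: "twist \<theta> (mpoly_var (Inl v) * q) x = u v * twist \<theta> q x"
  by (simp only: mpoly_var_def twist_single_mult monom_at_single hom_one sum.case mult_1_left)

lemma twist_Inr: "twist \<theta> (mpoly_var (Inr v) * q) x = twist \<theta> q (u v * x)"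
  by (simp only: mpoly_var_def twist_single_mult monom_at_single hom_one sum.case mult_1_left)

text \<open>The first copy stays outside \<theta>, so polynomials in it act through their value at
  \<open>u\<close>.\<close>

lemma twist_lcopy: "twist \<theta> (lcopy P * q) x = ev P u * twist \<theta> q x"
proof (induction P arbitrary: q x rule: mpoly_ring_induct)
  case (mult P Q)
  then show ?case by (simp add: ev_mult mult.assoc)
qed (simp_all add: twist_const twist_Inl twist_add ev_add distrib_right)

lemma twist_add_arg:
  "functional \<theta> \<Longrightarrow> twist \<theta> q (x + y) = twist \<theta> q x + twist \<theta> q y"
  by (simp add: functional_def twist_def distrib_left \<iota>_add sum.distrib)

lemma twist_scale_arg: "functional \<theta> \<Longrightarrow> c \<in> range \<iota> \<Longrightarrow> twist \<theta> q (c * x) = c * twist \<theta> q x"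
proof -
  assume lin: "functional \<theta>" and "c \<in> range \<iota>"
  then obtain d where c: "c = \<iota> d" by auto
  have *: "\<theta> (m * (c * x)) = d * \<theta> (m * x)" for m
    using lin by (metis functional_def c mult.left_commute)
  show ?thesis
    unfolding twist_def sum_distrib_left
    by (rule sum.cong, simp, simp only: * \<iota>_mult) (simp add: c mult_ac)
qed

text \<open>The second copy acts inside \<theta>; linearity lets sums and the constants, which lie
  in the subfield, pass through \<theta>.\<close>

lemma twist_rcopy:
  assumes "functional \<theta>"
  shows "twist \<theta> (rcopy P * q) x = twist \<theta> q (ev P u * x)"
proof (induction P arbitrary: q x rule: mpoly_ring_induct)
  case (const c)
  then show ?case by (simp add: twist_const twist_scale_arg[OF assms] \<kappa>_in)
next
  case (mult P Q)
  then show ?case by (simp add: ev_mult mult.assoc) (simp add: mult.left_commute)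
qed (simp_all add: twist_Inr twist_add twist_add_arg[OF assms] ev_add distrib_right)

text \<open>Take \<open>g = det N\<close>, where \<open>N\<close> holds the Taylor coefficients in
  the directions \<open>Inr j\<close> and becomes the Jacobian on the diagonal. Commuting with
  \<open>u (Inr j)\<close> means that \<open>y (Inr j) * g\<close> acts as zero, which Cramer's rule
  reduces to the rows of \<open>N\<close>.\<close>

lemma exists_commuting_twist:
  obtains g where "ev g (case_sum u u) \<noteq> 0"
    "\<And>\<theta> j x. functional \<theta> \<Longrightarrow> twist \<theta> g (u (Inr j) * x) = u (Inr j) * twist \<theta> g x"
proof -
  define y :: "'n + 'N \<Rightarrow> (('n + 'N) + ('n + 'N)) mpoly"
    where "y v = mpoly_var (Inl v) - mpoly_var (Inr v)" for v
  have "\<exists>M. lcopy (A i) - rcopy (A i) = (\<Sum>v\<in>UNIV. M v * y v) \<and>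
      (\<forall>v. ev (M v) (case_sum u u) = ev (mpoly_deriv v (A i)) u)" for i
    unfolding y_def by (rule taylor_first_order[of "A i" u]) blast
  then have "\<exists>M. \<forall>i. lcopy (A i) - rcopy (A i) = (\<Sum>v\<in>UNIV. M i v * y v) \<and>
      (\<forall>v. ev (M i v) (case_sum u u) = ev (mpoly_deriv v (A i)) u)"
    by (intro choice allI)
  then obtain M where taylor: "\<And>i. lcopy (A i) - rcopy (A i) = (\<Sum>v\<in>UNIV. M i v * y v)"
    and ev_M: "\<And>i v. ev (M i v) (case_sum u u) = ev (mpoly_deriv v (A i)) u"
    by blast
  define N where "N = (\<chi> i j. M i (Inr j))"
  \<comment> \<open>\<open>y v\<close> acts as a commutator with multiplication by
    \<open>u v\<close>; for linear \<theta> this is zero when \<open>u v\<close> lies in the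
    subfield.\<close>
  have y_Inr: "twist \<theta> (y v * q) x = u v * twist \<theta> q x - twist \<theta> q (u v * x)" for \<theta> v q x
    by (simp add: y_def left_diff_distrib twist_diff twist_Inl twist_Inr)
  \<comment> \<open>The Taylor identity writes this entry through \<open>lcopy (A i)\<close>,
    \<open>rcopy (A i)\<close> and the \<open>y (Inl k)\<close>. The copies act through
    \<open>ev (A i) u = 0\<close>, and the \<open>y (Inl k)\<close> are commutators with
    scalars.\<close>
  have row: "twist \<theta> (q * (N *v (\<chi> j. y (Inr j))) $ i) x = 0" if \<theta>: "functional \<theta>" for \<theta> q i x
  proof -
    have "(\<Sum>v\<in>UNIV. M i v * y v) = (\<Sum>k\<in>UNIV. M i (Inl k) * y (Inl k)) +
        (\<Sum>j\<in>UNIV. M i (Inr j) * y (Inr j))"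
      by (rule sum_UNIV_sum_type)
    then have "(N *v (\<chi> j. y (Inr j))) $ i =
        lcopy (A i) - rcopy (A i) - (\<Sum>k\<in>UNIV. M i (Inl k) * y (Inl k))"
      by (simp add: taylor N_def matrix_vector_mult_def)
    then have "q * (N *v (\<chi> j. y (Inr j))) $ i =
        lcopy (A i) * q - rcopy (A i) * q - (\<Sum>k\<in>UNIV. y (Inl k) * (M i (Inl k) * q))"
      by (simp only: right_diff_distrib sum_distrib_left) (simp add: mult_ac)
    moreover have "twist \<theta> (rcopy (A i) * q) x = 0"
      using twist_scale_arg[OF \<theta>, of 0 q 0] \<iota>_zero by (simp add: twist_rcopy[OF \<theta>] ev_A rev_image_eqI)
    ultimately show ?thesis
      by (simp add: twist_diff twist_lcopy ev_A twist_sum y_Inr twist_scale_arg[OF \<theta> u_in])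
  qed
  show thesis
  proof (rule that)
    show "ev (det N) (case_sum u u) \<noteq> 0"
      using jacobian by (simp add: N_def ev_det ev_M)
  next
    fix \<theta> j x
    assume \<theta>: "functional \<theta>"
    obtain c where "\<forall>x. det N * x $ j = (\<Sum>i\<in>UNIV. c i * (N *v x) $ i)"
      by (rule det_times_coord[of N j]) blast
    from this[rule_format, of "\<chi> j. y (Inr j)"]
    have "y (Inr j) * det N = (\<Sum>i\<in>UNIV. c i * (N *v (\<chi> j. y (Inr j))) $ i)"
      by (simp add: mult.commute)
    then have "twist \<theta> (y (Inr j) * det N) x = 0"
      by (simp only: twist_sum row[OF \<theta>]) simp
    then show "twist \<theta> (det N) (u (Inr j) * x) = u (Inr j) * twist \<theta> (det N) x"
      by (simp add: y_Inr)
  qed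
qed

text \<open>The values of \<open>twist \<theta> g\<close> lie in the span of finitely many left
  factors, and commutation puts all \<open>t ^ d * twist \<theta> g 1\<close> there. The summand
  \<open>\<iota> c\<close> lets a constant such as \<open>\<phi> j 0\<close> be added back.\<close>

theorem algebraic_elem_if_jacobian: "algebraic_elem (u (Inr j) + \<iota> c)"
proof -
  obtain g where g: "ev g (case_sum u u) \<noteq> 0"
    and comm: "\<And>\<theta> x. functional \<theta> \<Longrightarrow> twist \<theta> g (u (Inr j) * x) = u (Inr j) * twist \<theta> g x"
    by (rule exists_commuting_twist) blast
  let ?a = "\<lambda>m. \<kappa> (Poly_Mapping.lookup g m) * monom_at (case_sum u (\<lambda>_. 1)) m"
  let ?b = "\<lambda>m. monom_at (case_sum (\<lambda>_. 1) u) m"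
  \<comment> \<open>Splitting each doubled monomial presents \<open>ev g (case_sum u u)\<close> as
    the image of a tensor under multiplication.\<close>
  have "monom_at (case_sum u u) m = monom_at (case_sum u (\<lambda>_. 1)) m * ?b m" for m
    by (simp add: monom_at_def prod_UNIV_sum_type[where 'a = "'n + 'N" and 'b = "'n + 'N"])
  with g have "(\<Sum>m\<in>Poly_Mapping.keys g. ?a m * ?b m) \<noteq> 0"
    by (simp add: ev_def mult.assoc)
  then obtain \<theta> where \<theta>: "functional \<theta>"
    and nz: "(\<Sum>m\<in>Poly_Mapping.keys g. ?a m * \<iota> (\<theta> (?b m))) \<noteq> 0"
    by (rule functional_detects_tensor[OF finite_keys])
  define t where "t = u (Inr j) + \<iota> c"
  have "twist \<theta> g (t * x) = t * twist \<theta> g x" for x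
    by (simp add: t_def distrib_right twist_add_arg[OF \<theta>] twist_scale_arg[OF \<theta>] comm[OF \<theta>])
  then have pow: "twist \<theta> g (t ^ d) = t ^ d * twist \<theta> g 1" for d
    by (induction d) (simp_all add: mult.assoc)
  have span: "twist \<theta> g x \<in> vs.span (?a ` Poly_Mapping.keys g)" for x
    unfolding twist_def
  proof (rule vs.span_sum)
    fix m assume "m \<in> Poly_Mapping.keys g"
    then have "scale (\<theta> (?b m * x)) (?a m) \<in> vs.span (?a ` Poly_Mapping.keys g)"
      by (intro vs.span_scale vs.span_base) auto
    then show "?a m * \<iota> (\<theta> (?b m * x)) \<in> vs.span (?a ` Poly_Mapping.keys g)"
      by (simp add: scale_def mult.commute)
  qed
  show ?thesis
    unfolding t_def[symmetric]
  proof (rule algebraic_elem_if_powers_in_span)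
    show "twist \<theta> g 1 \<noteq> 0" using nz by (simp add: twist_def)
    show "t ^ d * twist \<theta> g 1 \<in> vs.span (?a ` Poly_Mapping.keys g)" for d
      using span[of "t ^ d"] by (simp only: pow)
  qed simp
qed

end

section \<open>Holomorphic functions of several variables and their germs\<close>

definition chol_at :: "(complex ^ 'n::finite \<Rightarrow> complex) \<Rightarrow> complex ^ 'n \<Rightarrow> bool" where
  "chol_at f z \<longleftrightarrow> (\<exists>L. (f has_derivative L) (at z) \<and> Vector_Spaces.linear (*s) (*) L)"

lemma complex_linear_iff:
  fixes L :: "complex ^ 'n::finite \<Rightarrow> complex"
  shows "Vector_Spaces.linear (*s) (*) L \<longleftrightarrow>
    (\<forall>x y. L (x + y) = L x + L y) \<and> (\<forall>c x. L (c *s x) = c * L x)"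
  by (simp add: Vector_Spaces.linear_iff vec.vector_space_axioms vector_space_over_itself.vector_space_axioms)

lemma holomorphic_vec_on_iff_chol_at:
  "open S \<Longrightarrow> holomorphic_vec_on f S \<longleftrightarrow> (\<forall>z\<in>S. chol_at f z)"
  by (simp add: holomorphic_vec_on_def chol_at_def at_within_open[of _ S])

lemma chol_at_const [simp, intro]: "chol_at (\<lambda>_. c) z"
  unfolding chol_at_def complex_linear_iff by (intro exI[of _ "\<lambda>_. 0"]) simp

lemma chol_at_nth [simp, intro]: "chol_at (\<lambda>z. z $ k) z"
  unfolding chol_at_def complex_linear_iff
  by (intro exI[of _ "\<lambda>z. z $ k"])
    (simp add: bounded_linear_imp_has_derivative bounded_linear_vec_nth)

lemma chol_at_add:
  assumes "chol_at f z" "chol_at g z"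
  shows "chol_at (\<lambda>z. f z + g z) z"
proof -
  obtain L M where "(f has_derivative L) (at z)" "Vector_Spaces.linear (*s) (*) L"
    "(g has_derivative M) (at z)" "Vector_Spaces.linear (*s) (*) M"
    using assms by (auto simp: chol_at_def)
  then show ?thesis
    unfolding chol_at_def complex_linear_iff
    by (intro exI[of _ "\<lambda>h. L h + M h"]) (auto intro: has_derivative_add simp: algebra_simps)
qed

lemma chol_at_mult:
  assumes "chol_at f z" "chol_at g z"
  shows "chol_at (\<lambda>z. f z * g z) z"
proof -
  obtain L M where "(f has_derivative L) (at z)" "Vector_Spaces.linear (*s) (*) L"
    "(g has_derivative M) (at z)" "Vector_Spaces.linear (*s) (*) M"
    using assms by (auto simp: chol_at_def)
  then show ?thesis
    unfolding chol_at_def complex_linear_iff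
    by (intro exI[of _ "\<lambda>h. f z * M h + L h * g z"]) (intro conjI has_derivative_mult, auto simp: algebra_simps)
qed

lemma chol_at_uminus: "chol_at f z \<Longrightarrow> chol_at (\<lambda>z. - f z) z"
  using chol_at_mult[of "\<lambda>_. - 1" z f] by simp

lemma chol_at_diff: "chol_at f z \<Longrightarrow> chol_at g z \<Longrightarrow> chol_at (\<lambda>z. f z - g z) z"
  using chol_at_add[OF _ chol_at_uminus] by simp

lemma chol_at_mpoly_eval:
  fixes P :: "'v::finite mpoly"
  assumes "\<And>v. chol_at (\<lambda>z. x z v) z"
  shows "chol_at (\<lambda>z. mpoly_eval P (x z)) z"
  by (induction P rule: mpoly_ring_induct)
    (auto simp: mpoly_eval_add mpoly_eval_mult intro: chol_at_add chol_at_mult assms)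

lemma chol_at_imp_isCont: "chol_at f z \<Longrightarrow> isCont f z"
  by (auto simp: chol_at_def dest: has_derivative_continuous)

text \<open>On the complex line through \<open>p\<close> and \<open>q\<close>, the part inside
  \<open>S\<close> is convex, hence connected, and the one-variable identity theorem
  applies.\<close>

lemma chol_eq_0_on_convex:
  fixes f :: "complex ^ 'n::finite \<Rightarrow> complex"
  assumes S: "open S" "convex S" and f: "\<And>z. z \<in> S \<Longrightarrow> chol_at f z"
    and p: "p \<in> S" "\<forall>\<^sub>F z in nhds p. f z = 0" and q: "q \<in> S"
  shows "f q = 0"
proof -
  define l where "l s = p + s *s (q - p)" for s
  define T where "T = {s. l s \<in> S}"
  have bl: "bounded_linear (\<lambda>s::complex. s *s (q - p))"
    unfolding linear_conv_bounded_linear[symmetric]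
    by (rule linearI) (simp_all add: vec_eq_iff algebra_simps)
  have l: "(l has_derivative (\<lambda>s. s *s (q - p))) (at s)" for s
    unfolding l_def using has_derivative_add[OF has_derivative_const bounded_linear_imp_has_derivative[OF bl]]
    by simp
  then have cont: "isCont l s" for s by (rule has_derivative_continuous)
  have "open (l -` S)"
    by (rule open_vimage[OF S(1)]) (simp add: cont continuous_at_imp_continuous_on)
  then have T: "open T" by (simp add: T_def vimage_def)
  have "convex T"
  proof (rule convexI)
    fix a b :: complex and s t :: real
    assume *: "a \<in> T" "b \<in> T" "0 \<le> s" "0 \<le> t" "s + t = 1"
    have t: "t = 1 - s" using * by simp
    have "l (s *\<^sub>R a + t *\<^sub>R b) = s *\<^sub>R l a + t *\<^sub>R l b"
      by (simp add: t l_def vec_eq_iff) (simp add: scaleR_conv_of_real algebra_simps)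
    then show "s *\<^sub>R a + t *\<^sub>R b \<in> T"
      using * S(2) by (simp add: T_def convexD)
  qed
  then have conn: "connected T" by (rule convex_connected)
  have hol: "(f \<circ> l) holomorphic_on T"
  proof (rule holomorphic_onI)
    fix s assume "s \<in> T"
    then obtain L where L: "(f has_derivative L) (at (l s))" "Vector_Spaces.linear (*s) (*) L"
      using f by (auto simp: T_def chol_at_def)
    have "(f \<circ> l has_derivative (\<lambda>r. L (r *s (q - p)))) (at s)"
      using diff_chain_at[OF l L(1)] by (simp add: o_def)
    \<comment> \<open>Complex linearity of \<open>L\<close> turns the real derivative along the line
      into a complex one.\<close>
    moreover have "(\<lambda>r. L (r *s (q - p))) = (*) (L (q - p))"
      using L(2) unfolding complex_linear_iff by (intro ext) (metis mult.commute)
    ultimately have "(f \<circ> l has_field_derivative L (q - p)) (at s)"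
      by (simp add: has_field_derivative_def)
    then show "(f \<circ> l) field_differentiable at s within T"
      using field_differentiable_at_within field_differentiable_def by blast
  qed
  have l0: "l 0 = p" and l1: "l 1 = q" by (simp_all add: l_def)
  have "\<forall>\<^sub>F s in nhds 0. f (l s) = 0"
    using p(2) cont[of 0] l0 by (auto simp: continuous_at filterlim_iff tendsto_def eventually_nhds_conv_at)
  moreover have "\<forall>\<^sub>F s in nhds 0. s \<in> T"
    using T p l0 by (intro eventually_nhds_in_open) (auto simp: T_def)
  ultimately have "\<forall>\<^sub>F s in nhds 0. s \<in> {s \<in> T. f (l s) = 0}"
    by eventually_elim auto
  then have in_U: "\<forall>\<^sub>F s in at 0. s \<in> {s \<in> T. f (l s) = 0}"
    by (simp add: eventually_nhds_conv_at)
  have lim: "0 islimpt {s \<in> T. f (l s) = 0}"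
    unfolding islimpt_iff_eventually
  proof
    assume "\<forall>\<^sub>F s in at 0. s \<notin> {s \<in> T. f (l s) = 0}"
    with in_U have "\<forall>\<^sub>F s in at (0 :: complex). False" by eventually_elim blast
    then show False by simp
  qed
  have "(f \<circ> l) 1 = 0"
  proof (rule analytic_continuation[OF hol T conn])
    show "{s \<in> T. f (l s) = 0} \<subseteq> T" by blast
    show "0 \<in> T" "1 \<in> T" using p(1) q by (simp_all only: T_def mem_Collect_eq l0 l1)
    show "0 islimpt {s \<in> T. f (l s) = 0}" by (rule lim)
    show "(f \<circ> l) s = 0" if "s \<in> {s \<in> T. f (l s) = 0}" for s using that by simp
  qed
  then show ?thesis by (simp add: l1)
qed

text \<open>The interior \<open>E\<close> of the zero set is open, and by the convex case on balls
  so is \<open>S - E\<close>; connectedness leaves only \<open>E\<close>.\<close>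

lemma chol_eq_0_on_connected:
  fixes f :: "complex ^ 'n::finite \<Rightarrow> complex"
  assumes S: "open S" "connected S" and f: "\<And>z. z \<in> S \<Longrightarrow> chol_at f z"
    and p: "p \<in> S" "\<forall>\<^sub>F z in nhds p. f z = 0" and q: "q \<in> S"
  shows "f q = 0"
proof -
  define E where "E = {z. \<forall>\<^sub>F w in nhds z. f w = 0}"
  have "open E"
  proof -
    have "E = \<Union>{S. open S \<and> (\<forall>w\<in>S. f w = 0)}"
      by (auto simp: E_def eventually_nhds)
    then show ?thesis by auto
  qed
  have "open (S - E)"
  proof (rule openI)
    fix z assume z: "z \<in> S - E"
    then obtain e where e: "e > 0" "ball z e \<subseteq> S" using S(1) open_contains_ball by blast
    have zero: "f w = 0" if x: "x \<in> ball z e" "x \<in> E" and w: "w \<in> ball z e" for x w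
    proof (rule chol_eq_0_on_convex[OF _ _ _ x(1) _ w])
      show "chol_at f y" if "y \<in> ball z e" for y
        using f e(2) that by blast
    qed (use x in \<open>auto simp: E_def\<close>)
    have near: "\<forall>\<^sub>F w in nhds z. w \<in> ball z e"
      using e by (intro eventually_nhds_in_open) auto
    have "x \<notin> E" if x: "x \<in> ball z e" for x
    proof
      assume "x \<in> E"
      have "\<forall>\<^sub>F w in nhds z. f w = 0"
        using near by (rule eventually_mono) (rule zero[OF x \<open>x \<in> E\<close>])
      with z show False by (simp add: E_def)
    qed
    then have "ball z e \<subseteq> S - E" using e(2) by blast
    with e(1) show "\<exists>e>0. ball z e \<subseteq> S - E" by blast
  qed
  with connectedD[OF S(2) \<open>open E\<close>, of "S - E"] p q have "q \<in> E"
    by (auto simp: E_def)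
  then show ?thesis unfolding E_def using eventually_nhds_x_imp_x by fast
qed

section \<open>The integral domain of holomorphic germs at the origin\<close>

definition chol_near :: "(complex ^ 'n::finite \<Rightarrow> complex) \<Rightarrow> bool" where
  "chol_near f \<longleftrightarrow> (\<forall>\<^sub>F z in nhds 0. chol_at f z)"

lemma chol_near_const [simp]: "chol_near (\<lambda>_. c)"
  by (simp add: chol_near_def)

lemma chol_near_add: "chol_near f \<Longrightarrow> chol_near g \<Longrightarrow> chol_near (\<lambda>z. f z + g z)"
  unfolding chol_near_def by (erule (1) eventually_elim2) (rule chol_at_add)

lemma chol_near_mult: "chol_near f \<Longrightarrow> chol_near g \<Longrightarrow> chol_near (\<lambda>z. f z * g z)"
  unfolding chol_near_def by (erule (1) eventually_elim2) (rule chol_at_mult)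

lemma chol_near_uminus: "chol_near f \<Longrightarrow> chol_near (\<lambda>z. - f z)"
  unfolding chol_near_def by (erule eventually_mono) (rule chol_at_uminus)

lemma chol_near_diff: "chol_near f \<Longrightarrow> chol_near g \<Longrightarrow> chol_near (\<lambda>z. f z - g z)"
  unfolding chol_near_def by (erule (1) eventually_elim2) (rule chol_at_diff)

lemma chol_near_mpoly_eval:
  fixes P :: "'v::finite mpoly"
  assumes "\<And>v. chol_near (\<lambda>z. x z v)"
  shows "chol_near (\<lambda>z. mpoly_eval P (x z))"
proof -
  have "\<forall>\<^sub>F z in nhds 0. \<forall>v. chol_at (\<lambda>z. x z v) z"
    using assms by (simp add: chol_near_def eventually_all_finite)
  then show ?thesis
    unfolding chol_near_def by eventually_elim (rule chol_at_mpoly_eval, blast)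
qed

text \<open>Germs have no zero divisors: where \<open>f\<close> is nonzero at a point,
  \<open>g\<close> vanishes around it, hence on the whole ball by the identity theorem.\<close>

lemma chol_near_mult_eq_0:
  fixes f g :: "complex ^ 'n::finite \<Rightarrow> complex"
  assumes f: "chol_near f" and g: "chol_near g" and fg: "\<forall>\<^sub>F z in nhds 0. f z * g z = 0"
  shows "(\<forall>\<^sub>F z in nhds 0. f z = 0) \<or> (\<forall>\<^sub>F z in nhds 0. g z = 0)"
proof -
  have "\<forall>\<^sub>F z in nhds 0. chol_at f z \<and> chol_at g z \<and> f z * g z = 0"
    using f g fg by (simp add: chol_near_def eventually_conj)
  then obtain e where e: "e > 0"
    and *: "\<And>z. z \<in> ball 0 e \<Longrightarrow> chol_at f z \<and> chol_at g z \<and> f z * g z = 0"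
    unfolding eventually_nhds_metric by (metis dist_commute mem_ball)
  have ev: "\<forall>\<^sub>F z in nhds (0::complex^'n). z \<in> ball 0 e"
    using e by (intro eventually_nhds_in_open) auto
  show ?thesis
  proof (cases "\<forall>z\<in>ball 0 e. f z = 0")
    case True
    with ev show ?thesis by (auto elim: eventually_mono)
  next
    case False
    then obtain p where p: "p \<in> ball 0 e" "f p \<noteq> 0" by blast
    have "isCont f p" using * p by (intro chol_at_imp_isCont) blast
    then have "\<forall>\<^sub>F z in at p. f z \<noteq> 0"
      using p(2) by (intro tendsto_imp_eventually_ne) (auto simp: continuous_at)
    then have "\<forall>\<^sub>F z in nhds p. f z \<noteq> 0"
      using p(2) by (simp add: eventually_nhds_conv_at)
    moreover have "\<forall>\<^sub>F z in nhds p. z \<in> ball 0 e"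
      using p by (intro eventually_nhds_in_open) auto
    ultimately have "\<forall>\<^sub>F z in nhds p. g z = 0"
      by eventually_elim (use * in fastforce)
    then have "g z = 0" if "z \<in> ball 0 e" for z
      using chol_eq_0_on_convex[of "ball 0 e" g p z] * p that by auto
    with ev have "\<forall>\<^sub>F z in nhds 0. g z = 0" by (auto elim: eventually_mono)
    then show ?thesis ..
  qed
qed

text \<open>Only a partial equivalence: reflexivity at \<open>f\<close> says that \<open>f\<close>
  is holomorphic near the origin.\<close>

definition germ_rel :: "(complex ^ 'n::finite \<Rightarrow> complex) \<Rightarrow> (complex ^ 'n \<Rightarrow> complex) \<Rightarrow> bool" where
  "germ_rel f g \<longleftrightarrow> chol_near f \<and> chol_near g \<and> (\<forall>\<^sub>F z in nhds 0. f z = g z)"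

lemma germ_rel_refl [simp]: "germ_rel f f \<longleftrightarrow> chol_near f"
  by (simp add: germ_rel_def)

quotient_type 'n germ = "complex ^ 'n::finite \<Rightarrow> complex" / partial: germ_rel
proof (rule part_equivpI)
  show "\<exists>f. germ_rel f f" by (intro exI[of _ "\<lambda>_. 0"]) simp
  show "symp germ_rel" by (rule sympI) (auto simp: germ_rel_def elim: eventually_mono)
  show "transp germ_rel"
    by (rule transpI) (auto simp: germ_rel_def elim: eventually_elim2)
qed

instantiation germ :: (finite) comm_ring_1
begin

lift_definition zero_germ :: "'a germ" is "\<lambda>_. 0" by simp
lift_definition one_germ :: "'a germ" is "\<lambda>_. 1" by simp
lift_definition plus_germ :: "'a germ \<Rightarrow> 'a germ \<Rightarrow> 'a germ" is "\<lambda>f g z. f z + g z"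
  by (auto simp: germ_rel_def intro!: chol_near_add elim: eventually_elim2)
lift_definition times_germ :: "'a germ \<Rightarrow> 'a germ \<Rightarrow> 'a germ" is "\<lambda>f g z. f z * g z"
  by (auto simp: germ_rel_def intro!: chol_near_mult elim: eventually_elim2)
lift_definition uminus_germ :: "'a germ \<Rightarrow> 'a germ" is "\<lambda>f z. - f z"
  by (auto simp: germ_rel_def intro!: chol_near_uminus elim: eventually_mono)
lift_definition minus_germ :: "'a germ \<Rightarrow> 'a germ \<Rightarrow> 'a germ" is "\<lambda>f g z. f z - g z"
  by (auto simp: germ_rel_def intro!: chol_near_diff elim: eventually_elim2)

instance
proof
  fix a b c :: "'a germ"
  show "a * b * c = a * (b * c)" "a * b = b * a" "1 * a = a" "a + b + c = a + (b + c)"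
    "a + b = b + a" "0 + a = a" "- a + a = 0" "a - b = a + - b" "(a + b) * c = a * c + b * c"
    by (transfer; simp add: germ_rel_def algebra_simps chol_near_add chol_near_mult chol_near_uminus chol_near_diff)+
  show "(0 :: 'a germ) \<noteq> 1"
    by transfer (simp add: germ_rel_def)
qed

end

instance germ :: (finite) idom
proof
  fix a b :: "'a germ"
  show "a \<noteq> 0 \<Longrightarrow> b \<noteq> 0 \<Longrightarrow> a * b \<noteq> 0"
    by transfer (use chol_near_mult_eq_0 in \<open>auto simp: germ_rel_def\<close>)
qed

lemma abs_germ_eq_iff:
  "chol_near f \<Longrightarrow> chol_near g \<Longrightarrow> abs_germ f = abs_germ g \<longleftrightarrow> (\<forall>\<^sub>F z in nhds 0. f z = g z)"
  using Quotient_rel[OF Quotient_germ, of f g] by (auto simp: germ_rel_def)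

lemma abs_germ_eq_0_iff: "chol_near f \<Longrightarrow> abs_germ f = 0 \<longleftrightarrow> (\<forall>\<^sub>F z in nhds 0. f z = 0)"
  by (simp add: zero_germ.abs_eq abs_germ_eq_iff)

section \<open>Polynomials as functions\<close>

lemma lookup_mpoly_deriv:
  "Poly_Mapping.lookup (mpoly_deriv v P) k =
    of_nat (Suc (Poly_Mapping.lookup k v)) * Poly_Mapping.lookup P (k + Poly_Mapping.single v 1)"
proof (induction P rule: mpoly_induct)
  case (single m c)
  let ?e = "Poly_Mapping.single v (1::nat)"
  show ?case
  proof (cases "m = k + ?e")
    case True
    then show ?thesis by (simp add: mpoly_deriv_single lookup_single lookup_add)
  next
    case False
    \<comment> \<open>Truncated subtraction can reach \<open>k\<close> from another monomial only if
      \<open>v\<close> does not occur in it, and then the coefficient is 0.\<close>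
    have "Poly_Mapping.lookup m v = 0" if "m - ?e = k"
    proof (rule ccontr)
      assume "Poly_Mapping.lookup m v \<noteq> 0"
      then have "m = (m - ?e) + ?e"
        by (intro poly_mapping_eqI) (auto simp: lookup_add lookup_minus lookup_single when_def)
      with that False show False by simp
    qed
    with False show ?thesis by (auto simp: mpoly_deriv_single lookup_single when_def)
  qed
qed (simp_all add: mpoly_deriv_add lookup_add algebra_simps)

lemma mpoly_deriv_all_zero:
  assumes "\<And>v. mpoly_deriv v P = 0"
  obtains c where "P = mpoly_const c"
proof -
  have "Poly_Mapping.lookup P m = 0" if m: "m \<noteq> 0" for m
  proof -
    obtain v where v: "Poly_Mapping.lookup m v \<noteq> 0"
      using m by (metis poly_mapping_eqI lookup_zero)
    let ?e = "Poly_Mapping.single v (1::nat)"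
    have "m = (m - ?e) + ?e"
      using v by (intro poly_mapping_eqI) (auto simp: lookup_add lookup_minus lookup_single when_def)
    with lookup_mpoly_deriv[of v P "m - ?e"] assms[of v] show ?thesis
      by (metis lookup_zero mult_eq_0_iff of_nat_eq_0_iff nat.distinct(2))
  qed
  then have "P = mpoly_const (Poly_Mapping.lookup P 0)"
    by (intro poly_mapping_eqI) (auto simp: mpoly_const_def lookup_single when_def)
  then show ?thesis by (rule that)
qed

lemma mpoly_eval_has_field_derivative:
  fixes P :: "'v::finite mpoly"
  shows "((\<lambda>s. mpoly_eval P (x(v := s))) has_field_derivative
    mpoly_eval (mpoly_deriv v P) (x(v := s))) (at s)"
proof (induction P rule: mpoly_ring_induct)
  case (var w)
  then show ?case by (cases "w = v") (simp_all add: mpoly_deriv_var)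
next
  case (mult A B)
  then show ?case
    by (simp add: mpoly_eval_mult mpoly_eval_add mpoly_deriv_mult)
      (auto intro!: derivative_eq_intros simp: algebra_simps)
qed (auto simp: mpoly_eval_add mpoly_deriv_add intro: DERIV_add)

text \<open>Partial derivatives also vanish on \<open>U\<close> and have smaller degree. By
  induction on a degree bound they are zero, so \<open>P\<close> is constant.\<close>

lemma mpoly_eq_0_if_eval_eq_0:
  fixes P :: "'v::finite mpoly" and U :: "(complex ^ 'v) set"
  assumes U: "open U" "U \<noteq> {}" and zero: "\<And>z. z \<in> U \<Longrightarrow> mpoly_eval P (\<lambda>v. z $ v) = 0"
  shows "P = 0"
proof -
  have "(\<forall>m\<in>Poly_Mapping.keys P. (\<Sum>v\<in>UNIV. Poly_Mapping.lookup m v) < n) \<Longrightarrow>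
      (\<forall>z\<in>U. mpoly_eval P (\<lambda>v. z $ v) = 0) \<Longrightarrow> P = 0" for n and P :: "'v mpoly"
  proof (induction n arbitrary: P)
    case 0
    then show ?case by simp
  next
    case (Suc n)
    have "mpoly_deriv v P = 0" for v
    proof (rule Suc.IH)
      show "\<forall>k\<in>Poly_Mapping.keys (mpoly_deriv v P). (\<Sum>w\<in>UNIV. Poly_Mapping.lookup k w) < n"
      proof
        fix k assume "k \<in> Poly_Mapping.keys (mpoly_deriv v P)"
        then have "k + Poly_Mapping.single v 1 \<in> Poly_Mapping.keys P"
          by (auto simp: in_keys_iff lookup_mpoly_deriv)
        with Suc.prems(1) have "(\<Sum>w\<in>UNIV. Poly_Mapping.lookup (k + Poly_Mapping.single v 1) w) < Suc n"
          by blast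
        then show "(\<Sum>w\<in>UNIV. Poly_Mapping.lookup k w) < n"
          by (simp add: lookup_add sum.distrib lookup_single when_def)
      qed
      show "\<forall>z\<in>U. mpoly_eval (mpoly_deriv v P) (\<lambda>w. z $ w) = 0"
      proof
        fix z assume z: "z \<in> U"
        \<comment> \<open>\<open>l\<close> moves the coordinate \<open>v\<close> alone, so openness
          of \<open>U\<close> gives vanishing near \<open>z $ v\<close>.\<close>
        define l where "l s = (\<chi> w. if w = v then s else z $ w)" for s
        have lz: "l (z $ v) = z" by (simp add: l_def vec_eq_iff)
        have nth: "(\<lambda>w. l s $ w) = (\<lambda>w. z $ w)(v := s)" for s
          by (auto simp: l_def)
        have "continuous_on UNIV l"
          unfolding l_def
        proof (rule continuous_on_vec_lambda)
          show "continuous_on UNIV (\<lambda>s. if w = v then s else z $ w)" for w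
            by (cases "w = v") simp_all
        qed
        then have "open (l -` U)" using U(1) by (simp add: open_vimage)
        then have "\<forall>\<^sub>F s in nhds (z $ v). s \<in> l -` U"
          by (rule eventually_nhds_in_open) (simp add: lz z)
        then have "\<forall>\<^sub>F s in nhds (z $ v). mpoly_eval P ((\<lambda>w. z $ w)(v := s)) = 0"
          by eventually_elim (use Suc.prems(2) nth in \<open>metis vimageD\<close>)
        then have "((\<lambda>s. mpoly_eval P ((\<lambda>w. z $ w)(v := s))) has_field_derivative 0) (at (z $ v))"
          by (subst DERIV_cong_ev[OF refl _ refl]) auto
        from DERIV_unique[OF mpoly_eval_has_field_derivative this]
        show "mpoly_eval (mpoly_deriv v P) (\<lambda>w. z $ w) = 0" by simp
      qed
    qed
    then obtain c where c: "P = mpoly_const c" by (rule mpoly_deriv_all_zero)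
    with Suc.prems(2) U(2) have "c = 0" by auto
    then show ?case by (simp add: c mpoly_const_def)
  qed
  moreover have "\<forall>m\<in>Poly_Mapping.keys P. (\<Sum>v\<in>UNIV. Poly_Mapping.lookup m v) <
      Suc (\<Sum>m\<in>Poly_Mapping.keys P. \<Sum>v\<in>UNIV. Poly_Mapping.lookup m v)"
    by (auto simp: less_Suc_eq_le intro!: member_le_sum)
  ultimately show ?thesis using zero by blast
qed

section \<open>Germs of polynomials and rational functions\<close>

definition mpoly_germ :: "'n::finite mpoly \<Rightarrow> 'n germ" where
  "mpoly_germ P = abs_germ (\<lambda>z. mpoly_eval P (\<lambda>k. z $ k))"

lemma chol_near_nth [simp]: "chol_near (\<lambda>z. z $ k)"
  by (simp add: chol_near_def)

lemma mpoly_germ_add: "mpoly_germ (P + Q) = mpoly_germ P + mpoly_germ Q"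
  by (simp add: mpoly_germ_def mpoly_eval_add plus_germ.abs_eq chol_near_mpoly_eval)

lemma mpoly_germ_mult: "mpoly_germ (P * Q) = mpoly_germ P * mpoly_germ Q"
  by (simp add: mpoly_germ_def mpoly_eval_mult times_germ.abs_eq chol_near_mpoly_eval)

lemma mpoly_germ_one: "mpoly_germ 1 = 1"
  by (simp add: mpoly_germ_def one_germ.abs_eq)

text \<open>This injectivity keeps denominators nonzero in \<open>ratfun_germ\<close>.\<close>

lemma mpoly_germ_eq_0_iff [simp]: "mpoly_germ P = 0 \<longleftrightarrow> P = 0"
proof
  assume "mpoly_germ P = 0"
  then have "\<forall>\<^sub>F z in nhds 0. mpoly_eval P (\<lambda>k. z $ k) = 0"
    by (simp add: mpoly_germ_def abs_germ_eq_0_iff chol_near_mpoly_eval)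
  then obtain U :: "(complex ^ 'a) set" where "open U" "0 \<in> U" "\<forall>z\<in>U. mpoly_eval P (\<lambda>k. z $ k) = 0"
    unfolding eventually_nhds by blast
  then show "P = 0" using mpoly_eq_0_if_eval_eq_0[of U P] by auto
qed (simp add: mpoly_germ_def zero_germ.abs_eq)

lift_definition ratfun_germ :: "'n::{finite,linorder} ratfun \<Rightarrow> 'n germ fract"
  is "\<lambda>(A, B). (mpoly_germ A, mpoly_germ B)"
  by (auto simp flip: mpoly_germ_mult)

lemma ratfun_germ_Fract:
  "B \<noteq> 0 \<Longrightarrow> ratfun_germ (Fract A B) = Fract (mpoly_germ A) (mpoly_germ B)"
  by (simp add: Fract.abs_eq ratfun_germ.abs_eq)

lemma ratfun_germ_to_fract [simp]: "ratfun_germ (to_fract A) = to_fract (mpoly_germ A)"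
  by (simp add: to_fract_def ratfun_germ_Fract mpoly_germ_one)

definition const_germ :: "complex \<Rightarrow> 'n::finite germ fract" where
  "const_germ c = to_fract (abs_germ (\<lambda>_. c))"

interpretation germ: complex_hom "const_germ :: complex \<Rightarrow> 'n::finite germ fract"
  by unfold_locales
    (simp_all add: const_germ_def plus_germ.abs_eq times_germ.abs_eq one_germ.abs_eq[symmetric]
      flip: to_fract_add to_fract_mult)

interpretation germ: field_hom "ratfun_germ :: 'n::{finite,linorder} ratfun \<Rightarrow> 'n germ fract"
proof
  fix a b :: "'n ratfun"
  obtain A B C E where ab: "a = Fract A B" "B \<noteq> 0" "b = Fract C E" "E \<noteq> 0"
    by (metis Fract_cases)
  then show "ratfun_germ (a + b) = ratfun_germ a + ratfun_germ b"
    "ratfun_germ (a * b) = ratfun_germ a * ratfun_germ b"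
    by (simp_all add: ratfun_germ_Fract mpoly_germ_add mpoly_germ_mult)
  show "ratfun_germ (1 :: 'n ratfun) = 1"
    using ratfun_germ_to_fract[of "1 :: 'n mpoly"] by (simp add: mpoly_germ_one)
qed

lemma ev_germ:
  fixes P :: "'v::finite mpoly" and x :: "complex ^ 'n::finite \<Rightarrow> 'v \<Rightarrow> complex"
  assumes x: "\<And>v. chol_near (\<lambda>z. x z v)"
  shows "germ.ev P (\<lambda>v. to_fract (abs_germ (\<lambda>z. x z v))) =
    to_fract (abs_germ (\<lambda>z. mpoly_eval P (x z)))"
proof -
  have *: "chol_near (\<lambda>z. mpoly_eval P (x z))" for P :: "'v mpoly"
    by (rule chol_near_mpoly_eval[OF x])
  show ?thesis
  proof (induction P rule: mpoly_ring_induct)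
    case (const c)
    show ?case unfolding germ.ev_const mpoly_eval_const by (rule const_germ_def)
  qed (simp_all add: germ.ev_add germ.ev_mult mpoly_eval_add mpoly_eval_mult *
      plus_germ.abs_eq times_germ.abs_eq flip: to_fract_add to_fract_mult)
qed

section \<open>Values of determinants of rational functions\<close>

text \<open>A relational form of \<open>ratfun_value\<close>: it carries definedness along through
  sums, products and determinants.\<close>

definition has_value :: "'v::linorder ratfun \<Rightarrow> ('v \<Rightarrow> complex) \<Rightarrow> complex \<Rightarrow> bool" where
  "has_value R x c \<longleftrightarrow>
    (\<exists>A B. R = Fract A B \<and> mpoly_eval B x \<noteq> 0 \<and> c = mpoly_eval A x / mpoly_eval B x)"

lemma has_valueI: "mpoly_eval B x \<noteq> 0 \<Longrightarrow> has_value (Fract A B) x (mpoly_eval A x / mpoly_eval B x)"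
  by (auto simp: has_value_def)

lemma has_value_imp_ratfun_value: "has_value R x c \<Longrightarrow> ratfun_value R x = c"
  by (auto simp: has_value_def ratfun_value_Fract)

lemma mpoly_eval_of_int: "mpoly_eval (of_int k) x = of_int k"
proof -
  have "mpoly_eval (of_nat n) x = of_nat n" for n
    by (induction n) (simp_all add: mpoly_eval_add)
  then show ?thesis
    by (cases k rule: int_cases2) (simp_all add: mpoly_eval_uminus)
qed

lemma has_value_of_int: "has_value (of_int k) x (of_int k)"
proof -
  have "(of_int k :: 'a ratfun) = Fract (of_int k) 1"
    by (cases k rule: int_cases2) (simp_all add: of_nat_fract)
  then show ?thesis
    using has_valueI[of 1 x "of_int k"] by (simp add: mpoly_eval_of_int)
qed

lemma has_value_add:
  assumes "has_value R x c" "has_value S x d"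
  shows "has_value (R + S) x (c + d)"
proof -
  obtain A B C E where *: "R = Fract A B" "mpoly_eval B x \<noteq> 0" "c = mpoly_eval A x / mpoly_eval B x"
    "S = Fract C E" "mpoly_eval E x \<noteq> 0" "d = mpoly_eval C x / mpoly_eval E x"
    using assms by (auto simp: has_value_def)
  then have "B \<noteq> 0" "E \<noteq> 0" by auto
  with * has_valueI[of "B * E" x "A * E + C * B"] show ?thesis
    by (simp add: mpoly_eval_mult mpoly_eval_add add_frac_eq)
qed

lemma has_value_mult: "has_value R x c \<Longrightarrow> has_value S x d \<Longrightarrow> has_value (R * S) x (c * d)"
  by (fastforce simp: has_value_def mpoly_eval_mult)

lemma has_value_sum:
  "(\<And>i. i \<in> I \<Longrightarrow> has_value (f i) x (c i)) \<Longrightarrow> has_value (sum f I) x (sum c I)"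
  using has_value_of_int[of 0]
  by (induction I rule: infinite_finite_induct) (auto intro: has_value_add)

lemma has_value_prod:
  "(\<And>i. i \<in> I \<Longrightarrow> has_value (f i) x (c i)) \<Longrightarrow> has_value (prod f I) x (prod c I)"
  using has_value_of_int[of 1]
  by (induction I rule: infinite_finite_induct) (auto intro: has_value_mult)

lemma has_value_det:
  "(\<And>i j. has_value (M $ i $ j) x (N $ i $ j)) \<Longrightarrow> has_value (det M) x (det N)"
  unfolding det_def by (intro has_value_sum has_value_mult has_value_prod has_value_of_int)

section \<open>From germs to functions\<close>

lemma clear_denominators:
  fixes p :: "'a::idom fract poly"
  obtains b q where "b \<noteq> 0" "\<And>d. to_fract b * coeff p d = to_fract (coeff q d)"
proof -
  have "\<exists>b q. b \<noteq> 0 \<and> (\<forall>d. to_fract b * coeff p d = to_fract (coeff q d))"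
  proof (induction p)
    case 0
    show ?case by (rule exI[of _ 1], rule exI[of _ 0]) simp
  next
    case (pCons a p)
    then obtain b q where bq: "b \<noteq> 0" "\<And>d. to_fract b * coeff p d = to_fract (coeff q d)"
      by blast
    obtain x y where a: "a = to_fract x / to_fract y" "y \<noteq> 0"
      by (metis Fract_cases Fract_conv_to_fract)
    have "to_fract (y * b) * coeff (pCons a p) d = to_fract (coeff (pCons (x * b) (smult y q)) d)" for d
      using a bq(2) by (cases d) (simp_all add: coeff_pCons mult.assoc)
    with a(2) bq(1) show ?case by (metis mult_eq_0_iff)
  qed
  then show ?thesis using that by blast
qed

lemma algebraic_germ_relation:
  fixes f :: "complex ^ 'n::{finite,linorder} \<Rightarrow> complex"
  assumes f: "chol_near f" and alg: "germ.algebraic_elem (to_fract (abs_germ f))"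
  obtains F :: "('n::{finite,linorder} + unit) mpoly" where "F \<noteq> 0"
    "\<forall>\<^sub>F z in nhds 0. mpoly_eval F (case_sum (\<lambda>k. z $ k) (\<lambda>_. f z)) = 0"
proof -
  obtain p :: "'n ratfun poly" where p: "p \<noteq> 0"
    and p0: "(\<Sum>d\<le>degree p. ratfun_germ (coeff p d) * to_fract (abs_germ f) ^ d) = 0"
    using alg unfolding germ.algebraic_elem_def germ.poly_map_poly_eq_sum by blast
  obtain b q where b: "b \<noteq> 0" and "\<forall>d. to_fract b * coeff p d = to_fract (coeff q d)"
    by (rule clear_denominators[of p]) blast
  then have q: "to_fract b * coeff p d = to_fract (coeff q d)" for d by blast
  \<comment> \<open>\<open>F\<close> is the relation \<open>p\<close> with cleared denominators, its
    indeterminate being the last variable.\<close>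
  define F :: "('n + unit) mpoly" where
    "F = (\<Sum>d\<le>degree p. const.ev (coeff q d) (\<lambda>k. mpoly_var (Inl k)) * mpoly_var (Inr ()) ^ d)"
  show thesis
  proof (rule that)
    show "F \<noteq> 0"
    proof
      assume "F = 0"
      \<comment> \<open>For fixed \<open>z\<close>, a polynomial in \<open>y\<close> whose values
        are all zero has zero coefficients.\<close>
      have "mpoly_eval (coeff q d) (\<lambda>k. z $ k) = 0" if d: "d \<le> degree p" for d and z :: "complex ^ 'n::{finite,linorder}"
      proof -
        have "(\<Sum>d\<le>degree p. mpoly_eval (coeff q d) (\<lambda>k. z $ k) * y ^ d) =
            mpoly_eval F (case_sum (\<lambda>k. z $ k) (\<lambda>_. y))" for y
          by (simp add: F_def mpoly_eval_eq_ev id.ev_sum id.ev_mult id.ev_power id.ev_compose)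
        with \<open>F = 0\<close> show ?thesis
          using d polyfun_eq_0[of "\<lambda>d. mpoly_eval (coeff q d) (\<lambda>k. z $ k)" "degree p"] by simp
      qed
      then have "coeff q (degree p) = 0"
        by (intro mpoly_eq_0_if_eval_eq_0[of UNIV]) auto
      with q[of "degree p"] b p show False by simp
    qed
    let ?x = "\<lambda>z. case_sum (\<lambda>k. z $ k) (\<lambda>_::unit. f z)"
    have x: "chol_near (\<lambda>z. ?x z v)" for v
      using f by (cases v) simp_all
    have near: "chol_near (\<lambda>z. mpoly_eval F (?x z))"
      by (rule chol_near_mpoly_eval) (rule x)
    have "ratfun_germ (to_fract b) * (\<Sum>d\<le>degree p. ratfun_germ (coeff p d) * to_fract (abs_germ f) ^ d) =
        (\<Sum>d\<le>degree p. to_fract (mpoly_germ (coeff q d)) * to_fract (abs_germ f) ^ d)"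
      unfolding sum_distrib_left mult.assoc[symmetric] germ.\<iota>_mult[symmetric] q
        ratfun_germ_to_fract[of "coeff q _"] ..
    also have "\<dots> = germ.ev F (\<lambda>v. to_fract (abs_germ (\<lambda>z. ?x z v)))"
      by (simp add: F_def germ.ev_sum germ.ev_mult germ.ev_power germ.ev_compose mpoly_germ_def ev_germ)
    also have "\<dots> = to_fract (abs_germ (\<lambda>z. mpoly_eval F (?x z)))"
      by (rule ev_germ[OF x])
    finally have "abs_germ (\<lambda>z. mpoly_eval F (?x z)) = 0"
      using p0 by simp
    then show "\<forall>\<^sub>F z in nhds 0. mpoly_eval F (?x z) = 0"
      by (simp only: abs_germ_eq_0_iff[OF near])
  qed
qed

theorem theorem6p2:
  fixes D :: "'N::{finite,linorder} \<Rightarrow> (complex ^ 'n::{finite,linorder}) set"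
    and \<phi> :: "'N \<Rightarrow> complex ^ 'n::{finite,linorder} \<Rightarrow> complex"
  assumes "DIRE_family D \<phi>"
  shows "\<forall>i. algebraic_function_on (D i) (\<phi> i)"
proof
  fix j
  define X where "X z = case_sum (\<lambda>k. z $ k) (\<lambda>j. \<phi> j z - \<phi> j 0)" for z
  from assms obtain \<Phi> :: "'N \<Rightarrow> ('n + 'N) ratfun" where
    D: "\<And>i. open (D i)" "\<And>i. connected (D i)" "\<And>i. 0 \<in> D i" "\<And>i. holomorphic_vec_on (\<phi> i) (D i)"
    and \<Phi>_def: "\<And>i. ratfun_defined_at (\<Phi> i) (\<lambda>_. 0)" and \<Phi>_0: "\<And>i. ratfun_value (\<Phi> i) (\<lambda>_. 0) = 0"
    and \<Phi>_det: "ratfun_value (det (\<chi> i j. ratfun_deriv (Inr j) (\<Phi> i))) (\<lambda>_. 0) \<noteq> 0"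
    and \<Phi>_\<phi>: "\<And>i. \<forall>\<^sub>F z in nhds 0. ratfun_value (\<Phi> i) (X z) = 0"
    unfolding DIRE_family_def X_def Let_def eventually_conj_iff by blast
  have chol: "chol_at (\<phi> i) z" if "z \<in> D i" for i z
    using D that holomorphic_vec_on_iff_chol_at by blast
  have near: "chol_near (\<phi> i)" for i
    unfolding chol_near_def
    using eventually_nhds_in_open[OF D(1) D(3)] by (rule eventually_mono) (rule chol)
  obtain A B where \<Phi>: "\<And>i. \<Phi> i = Fract (A i) (B i)" and B: "\<And>i. mpoly_eval (B i) (\<lambda>_. 0) \<noteq> 0"
    using \<Phi>_def unfolding ratfun_defined_at_def by metis
  have B_nz: "B i \<noteq> 0" for i using B[of i] by auto
  have A0: "mpoly_eval (A i) (\<lambda>_. 0) = 0" for i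
    using \<Phi>_0[of i] B[of i] by (simp add: \<Phi> ratfun_value_Fract)
  have X0: "X 0 = (\<lambda>_. 0)" by (auto simp: X_def split: sum.split)
  have X_near: "chol_near (\<lambda>z. X z v)" for v
    unfolding X_def by (cases v) (simp_all add: chol_near_diff near)
  \<comment> \<open>The denominator is nonzero near the origin by continuity, so the numerator must
    vanish there.\<close>
  have A_zero: "\<forall>\<^sub>F z in nhds 0. mpoly_eval (A i) (X z) = 0" for i
  proof -
    have "chol_at (\<lambda>z. mpoly_eval (B i) (X z)) 0"
      using chol_near_mpoly_eval[OF X_near] unfolding chol_near_def by (rule eventually_nhds_x_imp_x)
    then have "isCont (\<lambda>z. mpoly_eval (B i) (X z)) 0" by (rule chol_at_imp_isCont)
    then have "\<forall>\<^sub>F z in at 0. mpoly_eval (B i) (X z) \<noteq> 0"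
      by (rule tendsto_imp_eventually_ne[OF isContD]) (simp add: X0 B)
    then have "\<forall>\<^sub>F z in nhds 0. mpoly_eval (B i) (X z) \<noteq> 0"
      by (simp add: eventually_nhds_conv_at X0 B)
    with \<Phi>_\<phi>[of i] show ?thesis
      by eventually_elim (simp add: \<Phi> ratfun_value_Fract)
  qed
  define J where "J = (\<chi> i j. mpoly_deriv (Inr j) (A i))"
  \<comment> \<open>As \<open>A i\<close> vanishes at the origin, the quotient rule leaves the
    derivative of \<open>A i\<close> divided by \<open>B i\<close>. The two Jacobian determinants
    differ there by the nonzero product of the \<open>1 / B i\<close>.\<close>
  have J0: "mpoly_eval (det J) (\<lambda>_. 0) \<noteq> 0"
  proof
    assume "mpoly_eval (det J) (\<lambda>_. 0) = 0"
    then have J: "det (\<chi> i j. mpoly_eval (mpoly_deriv (Inr j) (A i)) (\<lambda>_. 0)) = 0"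
      by (simp add: mpoly_eval_eq_ev id.ev_det J_def)
    have "has_value (det (\<chi> i j. ratfun_deriv (Inr j) (\<Phi> i))) (\<lambda>_. 0)
      (det (\<chi> i. (1 / mpoly_eval (B i) (\<lambda>_. 0)) *s (\<chi> j. mpoly_eval (mpoly_deriv (Inr j) (A i)) (\<lambda>_. 0))))"
    proof (rule has_value_det)
      fix i j
      have "has_value (ratfun_deriv (Inr j) (\<Phi> i)) (\<lambda>_. 0)
          (mpoly_eval (mpoly_deriv (Inr j) (A i) * B i - A i * mpoly_deriv (Inr j) (B i)) (\<lambda>_. 0) /
            mpoly_eval (B i * B i) (\<lambda>_. 0))"
        unfolding \<Phi> ratfun_deriv_Fract[OF B_nz] using B by (intro has_valueI) (simp add: mpoly_eval_mult)
      then show "has_value ((\<chi> i j. ratfun_deriv (Inr j) (\<Phi> i)) $ i $ j) (\<lambda>_. 0)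
        ((\<chi> i. (1 / mpoly_eval (B i) (\<lambda>_. 0)) *s (\<chi> j. mpoly_eval (mpoly_deriv (Inr j) (A i)) (\<lambda>_. 0))) $ i $ j)"
        using B[of i] by (simp add: mpoly_eval_diff mpoly_eval_mult A0)
    qed
    then have "ratfun_value (det (\<chi> i j. ratfun_deriv (Inr j) (\<Phi> i))) (\<lambda>_. 0) = 0"
      unfolding det_rows_mul J by (simp add: has_value_imp_ratfun_value)
    with \<Phi>_det show False by simp
  qed
  define u where "u v = to_fract (abs_germ (\<lambda>z. X z v))" for v
  have ev_u: "germ.ev P u = to_fract (abs_germ (\<lambda>z. mpoly_eval P (X z)))" for P
    unfolding u_def by (rule ev_germ[OF X_near])
  have P_near: "chol_near (\<lambda>z. mpoly_eval P (X z))" for P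
    by (rule chol_near_mpoly_eval[OF X_near])
  have const_in: "const_germ c = ratfun_germ (to_fract (mpoly_const c))" for c
    by (simp add: const_germ_def mpoly_germ_def)
  interpret jacobian_criterion const_germ ratfun_germ A u
  proof
    show "const_germ c \<in> range ratfun_germ" for c unfolding const_in by (rule rangeI)
    show "u (Inl k) \<in> range ratfun_germ" for k
    proof -
      have "u (Inl k) = ratfun_germ (to_fract (mpoly_var k))"
        by (simp add: u_def X_def mpoly_germ_def)
      then show ?thesis by (metis rangeI)
    qed
    show "germ.ev (A i) u = 0" for i
      by (simp add: ev_u abs_germ_eq_0_iff P_near A_zero)
    \<comment> \<open>A zero germ would vanish at the origin itself, contrary to
      \<open>J0\<close>.\<close>
    show "germ.ev (det (\<chi> i j. mpoly_deriv (Inr j) (A i))) u \<noteq> 0"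
      unfolding J_def[symmetric] ev_u to_fract_eq_0_iff abs_germ_eq_0_iff[OF P_near]
      using J0 X0 eventually_nhds_x_imp_x by fastforce
  qed
  have "germ.algebraic_elem (u (Inr j) + const_germ (\<phi> j 0))"
    unfolding const_in by (rule algebraic_elem_if_jacobian)
  also have "u (Inr j) + const_germ (\<phi> j 0) = to_fract (abs_germ (\<phi> j))"
    by (simp add: u_def X_def const_germ_def plus_germ.abs_eq chol_near_diff near flip: to_fract_add)
  finally have alg: "germ.algebraic_elem (to_fract (abs_germ (\<phi> j)))" .
  obtain F :: "('n + unit) mpoly" where F: "F \<noteq> 0"
    "\<forall>\<^sub>F z in nhds 0. mpoly_eval F (case_sum (\<lambda>k. z $ k) (\<lambda>_. \<phi> j z)) = 0"
    by (rule algebraic_germ_relation[OF near alg])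
  \<comment> \<open>The relation near 0 spreads over the connected domain by the identity
    theorem.\<close>
  have "mpoly_eval F (case_sum (\<lambda>k. z $ k) (\<lambda>_. \<phi> j z)) = 0" if z: "z \<in> D j" for z
  proof (rule chol_eq_0_on_connected[OF D(1,2) _ D(3) F(2) z])
    fix z assume "z \<in> D j"
    show "chol_at (\<lambda>z. mpoly_eval F (case_sum (\<lambda>k. z $ k) (\<lambda>_. \<phi> j z))) z"
    proof (rule chol_at_mpoly_eval)
      show "chol_at (\<lambda>z. case_sum (\<lambda>k. z $ k) (\<lambda>_. \<phi> j z) v) z" for v
        using chol[OF \<open>z \<in> D j\<close>] by (cases v) simp_all
    qed
  qed
  with F(1) show "algebraic_function_on (D j) (\<phi> j)"
    unfolding algebraic_function_on_def by blast
qed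

end
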